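(* Consider the system $$\frac{d\varrho}{dt}=f(\varrho,\varphi,S(t),t),\qquad \frac{d\varphi}{dt}=\omega+g(\varrho,\varphi,S(t),t) \qquad (\ast)$$ satisfying the standing assumptions listed in the context (including the resonance condition $\kappa s_0=\varkappa\omega$ and the asymptotic expansions of $f$, $g$, $S'$). Then for all $N\in\mathbb Z_+$ and $\epsilon\in(0,\mathcal R/2)$ there exist $t_0>0$ and invertible transformations $(\varrho,\varphi)\mapsto(R,\Psi)\mapsto(r,\psi)$ of the form $$R(t)=\varrho(t),\qquad \Psi(t)=\varphi(t)-\frac{\kappa}{\varkappa}S(t),$$ $$r(t)=R(t)+\tilde U_N(R(t),\Psi(t),t),\qquad \psi(t)=\Psi(t)+\tilde V_N(R(t),\Psi(t),t),$$ where the functions $\tilde U_N(R,\Psi,t)$ and $\tilde V_N(R,\Psi,t)$ are smooth, $2\pi$-periodic in $\Psi$, and satisfy $$|\tilde U_N(R,\Psi,t)|\le\epsilon,\qquad |\tilde V_N(R,\Psi,t)|\le\epsilon\qquad \forall\,R\in(0,\mathcal R],\ \Psi\in\mathbb R,\ t\ge t_0,$$ such that system $(\ast)$ is transformed into $$\frac{dr}{dt}=\widehat\Lambda_N(r,\psi,t)+\widetilde\Lambda_N(r,\psi,S(t),t),\qquad \frac{d\psi}{dt}=\widehat\Omega_N(r,\psi,t)+\widetilde\Omega_N(r,\psi,S(t),t),$$ where $$\widehat\Lambda_N(r,\psi,t)\equiv\sum_{k=1}^N t^{-\frac kq}\Lambda_k(r,\psi),\qquad \widehat\Omega_N(r,\psi,t)\equiv\sum_{k=1}^N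 t^{-\frac kq}\Omega_k(r,\psi),$$ and the functions $\Lambda_k(r,\psi)$, $\Omega_k(r,\psi)$, $\widetilde\Lambda_N(r,\psi,S,t)$, $\widetilde\Omega_N(r,\psi,S,t)$ are defined for all $r\in(0,\mathcal R]$, $(\psi,S)\in\mathbb R^2$, are $2\pi$-periodic in $\psi$ and (the latter two) $2\pi\varkappa$-periodic in $S$. Moreover, $$\widetilde\Lambda_N(r,\psi,S,t)=\mathcal O\big(t^{-\frac{N+1}{q}}\big),\qquad \widetilde\Omega_N(r,\psi,S,t)=\mathcal O\big(t^{-\frac{N+1}{q}}\big)$$ as $t\to\infty$ uniformly for all $r\in[\epsilon,\mathcal R-\epsilon]$ and $(\psi,S)\in\mathbb R^2$.
   Context: Standing assumptions. $\omega>0$, $\mathcal R>0$, $q\in\mathbb Z_+$ (positive integers). The functions $f(\varrho,\varphi,S,t)$ and $g(\varrho,\varphi,S,t)$ are infinitely differentiable, defined for all $\varrho\in(0,\mathcal R]$, $(\varphi,S)\in\mathbb R^2$, $t>0$, and $2\pi$-periodic in $\varphi$ and in $S$. The function $S(t)$ is smooth for $t>0$ and $S'(t)\sim s_0$ as $t\to\infty$, where $s_0>0$ satisfies the resonance condition: there are coprime integers $\kappa,\varkappa$ with $\kappa s_0=\varkappa\omega$. For each fixed $\varrho,\varphi$, $\lim_{t\to\infty}f(\varrho,\varphi,S(t),t)=\lim_{t\to\infty}g(\varrho,\varphi,S(t),t)=0$. The following asymptotic expansions hold as $t\to\infty$ for all $\varrho\in(0,\mathcal R]$ and $(\varphi,S)\in\mathbb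 R^2$: $$f(\varrho,\varphi,S,t)\sim\sum_{k=1}^\infty t^{-\frac kq}f_k(\varrho,\varphi,S),\quad g(\varrho,\varphi,S,t)\sim\sum_{k=1}^\infty t^{-\frac kq}g_k(\varrho,\varphi,S),\quad S'(t)\sim s_0+\sum_{k=1}^\infty t^{-\frac kq}s_k,$$ where $f_k,g_k$ are smooth and $2\pi$-periodic in $\varphi$ and $S$, and $s_k$ are real parameters. *)

theory Defs
  imports "HOL-Analysis.Analysis" "HOL-Library.Landau_Symbols"
begin

text \<open>
  Functions of class C^n on a set \<open>D\<close>, in terms of Frechet derivatives relative to \<open>D\<close>.
  The sets used below are convex with nonempty interior, such as
  \<open>{0<..\<R>} \<times> UNIV \<times> UNIV \<times> {0<..}\<close>, so the derivative \<open>h'\<close> is unique; at the face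
  \<open>\<rho> = \<R>\<close> of such a set the derivatives are one-sided. As the domains are
  finite-dimensional, continuity of all directional derivatives \<open>\<lambda>x. h' x v\<close> is continuity
  of \<open>h'\<close>.
\<close>

primrec Ck_on :: "nat \<Rightarrow> 'a::real_normed_vector set \<Rightarrow> ('a \<Rightarrow> 'b::real_normed_vector) \<Rightarrow> bool" where
  "Ck_on 0 D h \<longleftrightarrow> continuous_on D h"
| "Ck_on (Suc n) D h \<longleftrightarrow>
     (\<exists>h'. (\<forall>x\<in>D. (h has_derivative h' x) (at x within D)) \<and> (\<forall>v. Ck_on n D (\<lambda>x. h' x v)))"

definition smooth_on :: "'a::real_normed_vector set \<Rightarrow> ('a \<Rightarrow> 'b::real_normed_vector) \<Rightarrow> bool" where
  "smooth_on D h \<longleftrightarrow> (\<forall>n. Ck_on n D h)"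

text \<open>
  Poincare asymptotic expansions in powers of \<open>t powr (-1/q)\<close> as \<open>t\<close> tends to infinity, each
  remainder being of smaller order than the last term kept: with a parameter \<open>x\<close>, uniformly
  for \<open>x\<close> in \<open>X\<close>, and without a parameter.
\<close>

definition asymp_series_on ::
    "'a set \<Rightarrow> nat \<Rightarrow> (real \<Rightarrow> 'a \<Rightarrow> real) \<Rightarrow> (nat \<Rightarrow> 'a \<Rightarrow> real) \<Rightarrow> bool" where
  "asymp_series_on X q h c \<longleftrightarrow>
     (\<forall>M::nat. uniform_limit X
        (\<lambda>t x. (h t x - (\<Sum>k=1..M. t powr (- (real k / real q)) * c k x)) / t powr (- (real M / real q)))
        (\<lambda>x. 0) at_top)"

definition asymp_series :: "nat \<Rightarrow> (real \<Rightarrow> real) \<Rightarrow> (nat \<Rightarrow> real) \<Rightarrow> bool" where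
  "asymp_series q h c \<longleftrightarrow>
     (\<forall>M::nat. (\<lambda>t. h t - (\<Sum>k=1..M. t powr (- (real k / real q)) * c k))
        \<in> o[at_top](\<lambda>t. t powr (- (real M / real q))))"

definition solves_on ::
    "real set \<Rightarrow> (real \<Rightarrow> real \<Rightarrow> real \<Rightarrow> real) \<Rightarrow> (real \<Rightarrow> real \<Rightarrow> real \<Rightarrow> real)
      \<Rightarrow> (real \<Rightarrow> real) \<Rightarrow> (real \<Rightarrow> real) \<Rightarrow> bool" where
  "solves_on T F G x y \<longleftrightarrow>
     (\<forall>t\<in>T. (x has_real_derivative F (x t) (y t) t) (at t within T) \<and>
            (y has_real_derivative G (x t) (y t) t) (at t within T))"

end

theory Submission
  imports Defs
begin

text \<open>
  With \<open>\<Psi> = \<phi> - (\<kappa> / \<nu>) S\<close>, resonance removes the constant term of \<open>\<Psi>'\<close>, so \<open>Z = (\<rho>, \<Psi>)\<close> is slow.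
  Put \<open>\<mu> = t powr (- 1 / q)\<close>, so that \<open>\<mu>' = - \<mu>^(q + 1) / q\<close>; after the radial variable is cut off
  near the ends of \<open>(0, \<R>]\<close>, the truncated expansions become a smooth vector field in
  \<open>(Z, \<sigma>, \<mu>)\<close>, periodic in \<open>\<Psi>\<close> and \<open>\<sigma>\<close>, on the whole space. The near-identity transformation is built
  order by order: the defect of conjugacy is \<open>\<mu>^(n+1)\<close> times a smooth function (division by \<open>\<mu>\<close> is
  Hadamard's lemma), whose oscillating part at \<open>\<mu> = 0\<close> is removed by integrating in \<open>\<sigma>\<close> and whose
  \<open>\<sigma>\<close>-mean is the next averaged term. For small \<open>\<mu>\<close> the transformation is the identity plus a
  contraction, hence expansive; this gives injectivity, surjectivity and the differentiability of
  \<open>Z\<close> from that of its image. Since the remainders enter the system only at \<open>\<sigma> = S t\<close>,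
  they can be taken constant in \<open>\<sigma>\<close>.
\<close>

section \<open>Calculus of smooth functions\<close>

text \<open>The obstacle is the end \<rho> = 0: the expansions are uniform only on [\<delta>, \<R>],
  while the transformation must be small and injective on all of (0, \<R>]. The cutoff separates the
  two demands. The transformation comes from a model field that is smooth for all real radii, so
  periodicity and compactness bound it together with its derivatives, and a factor \<mu> makes it
  small. The price is that model and exact field are close only for radii in
  [\<epsilon>/2, \<R> - \<epsilon>/2]; displacements of at most \<epsilon>/2 keep the preimages of
  [\<epsilon>, \<R> - \<epsilon>] inside that range, and elsewhere the remainder merely makes the
  equation exact. Treating \<mu> as an independent variable, with \<mu> = 0 included, turns
  manipulations of asymptotic series into identities between smooth functions. Since \<mu>' is
  O(\<mu>^2), differentiating a power of \<mu> never contributes at the order being solved.\<close>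

lemma Ck_on_SucI:
  assumes "\<And>x. x \<in> D \<Longrightarrow> (h has_derivative h' x) (at x within D)" and "\<And>v. Ck_on n D (\<lambda>x. h' x v)"
  shows "Ck_on (Suc n) D h"
  using assms by auto

lemma Ck_on_SucE:
  assumes "Ck_on (Suc n) D h"
  obtains h' where "\<And>x. x \<in> D \<Longrightarrow> (h has_derivative h' x) (at x within D)"
    and "\<And>v. Ck_on n D (\<lambda>x. h' x v)"
  using assms by auto

lemma Ck_on_Suc_imp: "Ck_on (Suc n) D h \<Longrightarrow> Ck_on n D h"
proof (induction n arbitrary: h)
  case 0
  then obtain h' where "\<And>x. x \<in> D \<Longrightarrow> (h has_derivative h' x) (at x within D)"
    by (rule Ck_on_SucE) blast
  then show ?case using has_derivative_continuous_on[of D h h'] by simp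
next
  case (Suc n)
  from Suc.prems show ?case
    by (rule Ck_on_SucE) (rule Ck_on_SucI, assumption, rule Suc.IH, blast)
qed

lemma Ck_on_imp_continuous_on: "Ck_on n D h \<Longrightarrow> continuous_on D h"
proof (induction n)
  case (Suc n)
  then show ?case using Ck_on_Suc_imp by blast
qed simp

lemma Ck_on_const: "Ck_on n D (\<lambda>x. c)"
proof (induction n arbitrary: c)
  case (Suc n)
  show ?case by (rule Ck_on_SucI[OF has_derivative_const Suc])
qed simp

lemma Ck_on_bounded_linear: "bounded_linear L \<Longrightarrow> Ck_on n D h \<Longrightarrow> Ck_on n D (\<lambda>x. L (h x))"
proof (induction n arbitrary: h)
  case 0
  then show ?case by (simp add: bounded_linear.continuous_on)
next
  case (Suc n)
  from Suc.prems(2) obtain h' where h': "\<And>x. x \<in> D \<Longrightarrow> (h has_derivative h' x) (at x within D)"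
    "\<And>v. Ck_on n D (\<lambda>x. h' x v)" by (rule Ck_on_SucE) blast
  show ?case
    by (rule Ck_on_SucI[OF bounded_linear.has_derivative[OF Suc.prems(1) h'(1)]
          Suc.IH[OF Suc.prems(1) h'(2)]])
qed

lemma Ck_on_id: "Ck_on n D (\<lambda>x. x)"
proof (cases n)
  case (Suc m)
  show ?thesis unfolding Suc by (rule Ck_on_SucI[OF has_derivative_ident Ck_on_const])
qed simp

lemma Ck_on_Pair: "Ck_on n D h \<Longrightarrow> Ck_on n D k \<Longrightarrow> Ck_on n D (\<lambda>x. (h x, k x))"
proof (induction n arbitrary: h k)
  case 0
  then show ?case by (simp add: continuous_on_Pair)
next
  case (Suc n)
  from Suc.prems(1) obtain h' where h': "\<And>x. x \<in> D \<Longrightarrow> (h has_derivative h' x) (at x within D)"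
    "\<And>v. Ck_on n D (\<lambda>x. h' x v)" by (rule Ck_on_SucE) blast
  from Suc.prems(2) obtain k' where k': "\<And>x. x \<in> D \<Longrightarrow> (k has_derivative k' x) (at x within D)"
    "\<And>v. Ck_on n D (\<lambda>x. k' x v)" by (rule Ck_on_SucE) blast
  show ?case
    by (rule Ck_on_SucI[OF has_derivative_Pair[OF h'(1) k'(1)] Suc.IH[OF h'(2) k'(2)]])
qed

lemma Ck_on_add:
  assumes "Ck_on n D h" "Ck_on n D k"
  shows "Ck_on n D (\<lambda>x. h x + k x)"
  using Ck_on_bounded_linear[OF bounded_linear_add[OF bounded_linear_fst bounded_linear_snd]
      Ck_on_Pair[OF assms]] by simp

lemma Ck_on_sum: "(\<And>i. i \<in> I \<Longrightarrow> Ck_on n D (h i)) \<Longrightarrow> Ck_on n D (\<lambda>x. \<Sum>i\<in>I. h i x)"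
  by (induction I rule: infinite_finite_induct) (simp_all add: Ck_on_const Ck_on_add)

lemma Ck_on_bounded_bilinear:
  assumes "bounded_bilinear p"
  shows "Ck_on n D h \<Longrightarrow> Ck_on n D k \<Longrightarrow> Ck_on n D (\<lambda>x. p (h x) (k x))"
proof (induction n arbitrary: h k)
  case 0
  then show ?case using bounded_bilinear.continuous_on[OF assms] by simp
next
  case (Suc n)
  from Suc.prems(1) obtain h' where h': "\<And>x. x \<in> D \<Longrightarrow> (h has_derivative h' x) (at x within D)"
    "\<And>v. Ck_on n D (\<lambda>x. h' x v)" by (rule Ck_on_SucE) blast
  from Suc.prems(2) obtain k' where k': "\<And>x. x \<in> D \<Longrightarrow> (k has_derivative k' x) (at x within D)"
    "\<And>v. Ck_on n D (\<lambda>x. k' x v)" by (rule Ck_on_SucE) blast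
  show ?case
    by (rule Ck_on_SucI[OF bounded_bilinear.FDERIV[OF assms h'(1) k'(1)]
          Ck_on_add[OF Suc.IH[OF Ck_on_Suc_imp[OF Suc.prems(1)] k'(2)]
            Suc.IH[OF h'(2) Ck_on_Suc_imp[OF Suc.prems(2)]]]])
qed

text \<open>The inner derivative \<open>h' x v\<close> moves with x, whereas \<open>Ck_on\<close>
  controls derivatives only in fixed directions. Expanding \<open>h' x v\<close> in a basis of the
  intermediate space leaves products to which the induction hypothesis applies.\<close>

lemma Ck_on_compose:
  fixes h :: "'a::real_normed_vector \<Rightarrow> 'b::euclidean_space" and k :: "'b \<Rightarrow> 'c::real_normed_vector"
  shows "Ck_on n E k \<Longrightarrow> Ck_on n D h \<Longrightarrow> h ` D \<subseteq> E \<Longrightarrow> Ck_on n D (\<lambda>x. k (h x))"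
proof (induction n arbitrary: k)
  case 0
  then show ?case by (auto intro: continuous_on_compose2)
next
  case (Suc n)
  from Suc.prems(2) obtain h' where h': "\<And>x. x \<in> D \<Longrightarrow> (h has_derivative h' x) (at x within D)"
    "\<And>v. Ck_on n D (\<lambda>x. h' x v)" by (rule Ck_on_SucE) blast
  from Suc.prems(1) obtain k' where k': "\<And>x. x \<in> E \<Longrightarrow> (k has_derivative k' x) (at x within E)"
    "\<And>v. Ck_on n E (\<lambda>x. k' x v)" by (rule Ck_on_SucE) blast
  have hn: "Ck_on n D h" using Suc.prems(2) by (rule Ck_on_Suc_imp)
  let ?d = "\<lambda>x v. \<Sum>b\<in>Basis. (h' x v \<bullet> b) *\<^sub>R k' (h x) b"
  have "((\<lambda>x. k (h x)) has_derivative ?d x) (at x within D)" if "x \<in> D" for x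
  proof -
    have kd: "(k has_derivative k' (h x)) (at (h x) within h ` D)"
      by (rule has_derivative_subset[OF k'(1) Suc.prems(3)]) (use Suc.prems(3) that in blast)
    have "((\<lambda>x. k (h x)) has_derivative (\<lambda>v. k' (h x) (h' x v))) (at x within D)"
      by (rule has_derivative_in_compose[OF h'(1)[OF that] kd])
    moreover have "k' (h x) (h' x v) = ?d x v" for v
    proof -
      interpret bounded_linear "k' (h x)" using kd by (rule has_derivative_bounded_linear)
      have "k' (h x) (h' x v) = k' (h x) (\<Sum>b\<in>Basis. (h' x v \<bullet> b) *\<^sub>R b)"
        by (simp add: euclidean_representation)
      then show ?thesis by (simp add: sum scaleR)
    qed
    ultimately show ?thesis by (simp only:)
  qed
  moreover have "Ck_on n D (\<lambda>x. ?d x v)" for v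
  proof (rule Ck_on_sum, rule Ck_on_bounded_bilinear[OF bounded_bilinear_scaleR])
    fix b :: 'b
    show "Ck_on n D (\<lambda>x. h' x v \<bullet> b)"
      by (rule Ck_on_bounded_linear[OF bounded_linear_inner_left h'(2)])
    show "Ck_on n D (\<lambda>x. k' (h x) b)"
      by (rule Suc.IH[OF k'(2) hn Suc.prems(3)])
  qed
  ultimately show ?case by (rule Ck_on_SucI)
qed

text \<open>Differentiation under the integral sign gives the integral of
  \<open>h' (x, \<tau>) (v, 0)\<close>, which has the same form, so the induction closes. The
  Leibniz rule asks for continuity in operator norm; in finite dimension this follows from
  continuity in each basis direction.\<close>

lemma Ck_on_integral:
  fixes h :: "'a::euclidean_space \<times> real \<Rightarrow> 'b::euclidean_space"
  shows "Ck_on n UNIV h \<Longrightarrow> Ck_on n UNIV (\<lambda>x. integral {0..1} (\<lambda>\<tau>. h (x, \<tau>)))"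
proof (induction n arbitrary: h)
  case 0
  then have "continuous_on (UNIV \<times> cbox 0 (1::real)) (\<lambda>(x, \<tau>). h (x, \<tau>))"
    by (auto intro: continuous_on_subset)
  from integral_continuous_on_param[OF this] show ?case by simp
next
  case (Suc n)
  from Suc.prems obtain h' where h': "\<And>x. (h has_derivative h' x) (at x)"
    "\<And>v. Ck_on n UNIV (\<lambda>x. h' x v)" by (rule Ck_on_SucE) (use UNIV_I in blast)
  have hc: "continuous_on UNIV h" using Suc.prems by (rule Ck_on_imp_continuous_on)
  have bl: "bounded_linear (\<lambda>v. h' (x, \<tau>) (v, 0))" for x \<tau>
    by (intro bounded_linear_compose[OF has_derivative_bounded_linear[OF h'(1)]]
        bounded_linear_Pair bounded_linear_ident bounded_linear_zero)
  define d where "d x \<tau> = Blinfun (\<lambda>v. h' (x, \<tau>) (v, 0))" for x \<tau>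
  have d: "blinfun_apply (d x \<tau>) = (\<lambda>v. h' (x, \<tau>) (v, 0))" for x \<tau>
    using bl bounded_linear_Blinfun_apply by (auto simp: d_def)
  have dc: "continuous_on UNIV (\<lambda>(x, \<tau>). d x \<tau>)"
  proof (rule continuous_on_blinfun_componentwise)
    fix i :: 'a
    show "continuous_on UNIV (\<lambda>x. blinfun_apply (case x of (x, \<tau>) \<Rightarrow> d x \<tau>) i)"
      using Ck_on_imp_continuous_on[OF h'(2)[of "(i, 0)"]] by (simp add: case_prod_beta d)
  qed
  let ?D = "\<lambda>x v. integral {0..1} (\<lambda>\<tau>. h' (x, \<tau>) (v, 0))"
  have "((\<lambda>x. integral {0..1} (\<lambda>\<tau>. h (x, \<tau>))) has_derivative ?D x) (at x)" for x
  proof -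
    have "((\<lambda>x. integral (cbox 0 1) (\<lambda>\<tau>. h (x, \<tau>))) has_derivative
        integral (cbox 0 1) (d x)) (at x within UNIV)"
    proof (rule leibniz_rule)
      fix x :: 'a and \<tau> :: real
      have "((\<lambda>x. (x, \<tau>)) has_derivative (\<lambda>v. (v, 0))) (at x)"
        by (auto intro!: derivative_eq_intros)
      from has_derivative_compose[OF this h'(1)]
      show "((\<lambda>x. h (x, \<tau>)) has_derivative blinfun_apply (d x \<tau>)) (at x within UNIV)"
        by (simp add: d)
      show "(\<lambda>\<tau>. h (x, \<tau>)) integrable_on cbox 0 1"
        by (intro integrable_continuous continuous_on_compose2[OF hc] continuous_intros) auto
    qed (use dc in \<open>auto intro: continuous_on_subset\<close>)
    moreover have "blinfun_apply (integral (cbox 0 1) (d x)) = ?D x"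
    proof
      fix v
      have "continuous_on {0..1} (d x)"
        using continuous_on_compose2[OF dc, of "{0..1}" "\<lambda>\<tau>. (x, \<tau>)"]
        by (simp add: continuous_intros)
      then have "d x integrable_on cbox 0 1" by (simp add: integrable_continuous_real)
      from integral_linear[OF this bounded_linear_apply_blinfun[of v]]
      show "blinfun_apply (integral (cbox 0 1) (d x)) v = ?D x v" by (simp add: o_def d)
    qed
    ultimately show ?thesis by simp
  qed
  moreover have "Ck_on n UNIV (\<lambda>x. ?D x v)" for v
    by (rule Suc.IH[OF h'(2)])
  ultimately show ?case by (rule Ck_on_SucI)
qed

section \<open>Concrete smooth functions: real powers and flat exponentials\<close>

lemma Ck_on_powr: "Ck_on n {0<..} (\<lambda>t::real. t powr a)"
proof (induction n arbitrary: a)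
  case 0
  then show ?case by (auto intro!: continuous_intros)
next
  case (Suc n)
  have "((\<lambda>t. t powr a) has_derivative (\<lambda>v. v * (a * t powr (a - 1)))) (at t within {0<..})"
    if "t \<in> {0<..}" for t
    using that by (auto intro!: derivative_eq_intros simp: powr_diff field_simps)
  moreover have "Ck_on n {0<..} (\<lambda>t. v * (a * t powr (a - 1)))" for v
    by (intro Ck_on_bounded_linear[OF bounded_linear_mult_right] Suc.IH)
  ultimately show ?case by (rule Ck_on_SucI)
qed

text \<open>The powers of \<open>1 / x\<close> make this family closed under differentiation.\<close>

definition flat :: "nat \<Rightarrow> real \<Rightarrow> real" where
  "flat k x = (if x > 0 then (1 / x) ^ k * exp (- (1 / x)) else 0)"

lemma flat_tendsto_0: "(flat k \<longlongrightarrow> 0) (at 0)"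
proof (rule filterlim_split_at)
  show "(flat k \<longlongrightarrow> 0) (at_left 0)"
    by (rule tendsto_eventually) (auto simp: eventually_at_filter flat_def)
  have "((\<lambda>x::real. (1 / x) ^ k / exp (1 / x)) \<longlongrightarrow> 0) (at_right 0)"
    using filterlim_compose[OF tendsto_power_div_exp_0 filterlim_inverse_at_top_right]
    by (simp add: divide_inverse)
  then show "(flat k \<longlongrightarrow> 0) (at_right 0)"
    by (rule Lim_transform_eventually)
      (auto simp: eventually_at_filter flat_def exp_minus divide_inverse)
qed

lemma flat_has_real_derivative:
  "(flat k has_real_derivative flat (k + 2) x - real k * flat (k + 1) x) (at x)"
proof -
  consider "x > 0" | "x < 0" | "x = 0" by linarith
  then show ?thesis
  proof cases
    case 1
    have inv: "((\<lambda>x. 1 / x) has_real_derivative - ((1 / x) * (1 / x))) (at x)"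
      using 1 by (auto intro!: derivative_eq_intros)
    have pow: "((\<lambda>x. (1 / x) ^ k) has_real_derivative - (real k * (1 / x) ^ (k + 1))) (at x)"
    proof (cases k)
      case (Suc m)
      show ?thesis
        unfolding Suc by (rule DERIV_cong[OF DERIV_power_Suc[OF inv]]) (simp add: algebra_simps)
    qed simp
    have ex: "((\<lambda>x. exp (- (1 / x))) has_real_derivative (exp (- (1 / x)) * ((1 / x) * (1 / x)))) (at x)"
      using DERIV_fun_exp[OF DERIV_minus[OF inv]] by simp
    have "((\<lambda>x. (1 / x) ^ k * exp (- (1 / x))) has_real_derivative
        flat (k + 2) x - real k * flat (k + 1) x) (at x)"
      using DERIV_mult[OF pow ex] 1 by (simp add: flat_def power_add power2_eq_square algebra_simps)
    then show ?thesis
      by (rule has_field_derivative_transform_within_open[of _ _ _ "{0<..}"])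
        (use 1 in \<open>auto simp: flat_def\<close>)
  next
    case 2
    have "((\<lambda>x. 0) has_real_derivative flat (k + 2) x - real k * flat (k + 1) x) (at x)"
      using 2 by (simp add: flat_def)
    then show ?thesis
      by (rule has_field_derivative_transform_within_open[of _ _ _ "{..<0}"])
        (use 2 in \<open>auto simp: flat_def\<close>)
  next
    case 3
    \<comment> \<open>The difference quotient at 0 stays in the family: it is
      \<open>flat (Suc k) h\<close>.\<close>
    have "((\<lambda>h. (flat k (0 + h) - flat k 0) / h) \<longlongrightarrow> 0) (at 0)"
      by (rule Lim_transform_eventually[OF flat_tendsto_0[of "Suc k"]])
        (auto simp: eventually_at_filter flat_def)
    then show ?thesis using 3 by (simp add: DERIV_def flat_def)
  qed
qed

lemma Ck_on_flat: "Ck_on n UNIV (flat k)"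
proof (induction n arbitrary: k)
  case 0
  have "continuous_on UNIV (flat k)"
    by (rule DERIV_continuous_on[OF flat_has_real_derivative])
  then show ?case by simp
next
  case (Suc n)
  have "Ck_on n UNIV (\<lambda>x. (flat (k + 2) x - real k * flat (k + 1) x) * v)" for v
    using Ck_on_bounded_linear[OF bounded_linear_mult_left[of v] Ck_on_add[OF Suc.IH[of "k + 2"]
          Ck_on_bounded_linear[OF bounded_linear_mult_right[of "- real k"] Suc.IH[of "k + 1"]]]]
    by simp
  then show ?case
    using flat_has_real_derivative unfolding has_field_derivative_def by (intro Ck_on_SucI)
qed

section \<open>Functions of class C^infinity\<close>

named_theorems smooth_intros

lemma smooth_on_imp_continuous_on: "smooth_on D h \<Longrightarrow> continuous_on D h"
  unfolding smooth_on_def using Ck_on_imp_continuous_on by blast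

lemma smooth_on_const [smooth_intros]: "smooth_on D (\<lambda>x. c)"
  by (simp add: smooth_on_def Ck_on_const)

lemma smooth_on_id [smooth_intros]: "smooth_on D (\<lambda>x. x)"
  by (simp add: smooth_on_def Ck_on_id)

lemma smooth_on_Pair [smooth_intros]:
  "smooth_on D h \<Longrightarrow> smooth_on D k \<Longrightarrow> smooth_on D (\<lambda>x. (h x, k x))"
  by (simp add: smooth_on_def Ck_on_Pair)

lemma smooth_on_bounded_linear: "bounded_linear L \<Longrightarrow> smooth_on D h \<Longrightarrow> smooth_on D (\<lambda>x. L (h x))"
  by (simp add: smooth_on_def Ck_on_bounded_linear)

lemmas smooth_on_fst [smooth_intros] = smooth_on_bounded_linear[OF bounded_linear_fst]
lemmas smooth_on_snd [smooth_intros] = smooth_on_bounded_linear[OF bounded_linear_snd]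
lemmas smooth_on_minus [smooth_intros] =
  smooth_on_bounded_linear[OF bounded_linear_minus[OF bounded_linear_ident]]

lemma smooth_on_add [smooth_intros]:
  "smooth_on D h \<Longrightarrow> smooth_on D k \<Longrightarrow> smooth_on D (\<lambda>x. h x + k x)"
  by (simp add: smooth_on_def Ck_on_add)

lemma smooth_on_diff [smooth_intros]:
  "smooth_on D h \<Longrightarrow> smooth_on D k \<Longrightarrow> smooth_on D (\<lambda>x. h x - k x)"
  using smooth_on_add[of D h "\<lambda>x. - k x"] smooth_on_minus by auto

lemma smooth_on_sum [smooth_intros]:
  "(\<And>i. i \<in> I \<Longrightarrow> smooth_on D (h i)) \<Longrightarrow> smooth_on D (\<lambda>x. \<Sum>i\<in>I. h i x)"
  by (simp add: smooth_on_def Ck_on_sum)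

lemma smooth_on_bounded_bilinear:
  "bounded_bilinear p \<Longrightarrow> smooth_on D h \<Longrightarrow> smooth_on D k \<Longrightarrow> smooth_on D (\<lambda>x. p (h x) (k x))"
  by (simp add: smooth_on_def Ck_on_bounded_bilinear)

lemmas smooth_on_scaleR [smooth_intros] = smooth_on_bounded_bilinear[OF bounded_bilinear_scaleR]
lemmas smooth_on_mult [smooth_intros] = smooth_on_bounded_bilinear[OF bounded_bilinear_mult]
lemmas smooth_on_inner [smooth_intros] = smooth_on_bounded_bilinear[OF bounded_bilinear_inner]

lemma smooth_on_power [smooth_intros]:
  fixes h :: "'a::real_normed_vector \<Rightarrow> real"
  shows "smooth_on D h \<Longrightarrow> smooth_on D (\<lambda>x. h x ^ k)"
  by (induction k) (simp_all add: smooth_intros)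

lemma smooth_on_compose:
  fixes h :: "'a::real_normed_vector \<Rightarrow> 'b::euclidean_space" and k :: "'b \<Rightarrow> 'c::real_normed_vector"
  shows "smooth_on E k \<Longrightarrow> smooth_on D h \<Longrightarrow> h ` D \<subseteq> E \<Longrightarrow> smooth_on D (\<lambda>x. k (h x))"
  unfolding smooth_on_def using Ck_on_compose by blast

lemma smooth_on_compose_UNIV:
  fixes h :: "'a::real_normed_vector \<Rightarrow> 'b::euclidean_space" and k :: "'b \<Rightarrow> 'c::real_normed_vector"
  shows "smooth_on UNIV k \<Longrightarrow> smooth_on D h \<Longrightarrow> smooth_on D (\<lambda>x. k (h x))"
  by (rule smooth_on_compose) auto

lemma smooth_on_integral:
  fixes h :: "'a::euclidean_space \<times> real \<Rightarrow> 'b::euclidean_space"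
  shows "smooth_on UNIV h \<Longrightarrow> smooth_on UNIV (\<lambda>x. integral {0..1} (\<lambda>\<tau>. h (x, \<tau>)))"
  by (simp add: smooth_on_def Ck_on_integral)

lemma smooth_on_powr: "smooth_on {0<..} (\<lambda>t::real. t powr a)"
  by (simp add: smooth_on_def Ck_on_powr)

lemma smooth_on_imp_has_derivative:
  assumes "smooth_on D h" "open D" "x \<in> D"
  shows "(h has_derivative frechet_derivative h (at x)) (at x)"
proof -
  have "Ck_on (Suc 0) D h" using assms(1) by (simp add: smooth_on_def)
  then obtain h' where "\<And>x. x \<in> D \<Longrightarrow> (h has_derivative h' x) (at x within D)"
    by (rule Ck_on_SucE) blast
  from this[OF assms(3)] have "h differentiable at x"
    unfolding at_within_open[OF assms(3,2)] by (rule differentiableI)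
  then show ?thesis by (simp add: frechet_derivative_works)
qed

lemma smooth_on_imp_has_real_derivative:
  fixes h :: "real \<Rightarrow> real"
  assumes "smooth_on D h" "open D" "x \<in> D"
  shows "(h has_real_derivative deriv h x) (at x)"
proof -
  have "h differentiable at x"
    using smooth_on_imp_has_derivative[OF assms] by (rule differentiableI)
  then show ?thesis using DERIV_deriv_iff_real_differentiable by blast
qed

lemma smooth_imp_has_derivative:
  "smooth_on UNIV h \<Longrightarrow> (h has_derivative frechet_derivative h (at x)) (at x)"
  by (rule smooth_on_imp_has_derivative) auto

lemma smooth_frechet_derivative:
  assumes "smooth_on UNIV h"
  shows "smooth_on UNIV (\<lambda>x. frechet_derivative h (at x) v)"
  unfolding smooth_on_def
proof
  fix n
  have "Ck_on (Suc n) UNIV h" using assms by (simp add: smooth_on_def)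
  then obtain h' where h': "\<And>x. (h has_derivative h' x) (at x)" "\<And>v. Ck_on n UNIV (\<lambda>x. h' x v)"
    by (rule Ck_on_SucE) (use UNIV_I in blast)
  have "frechet_derivative h (at x) = h' x" for x
    using h'(1)[of x] by (rule frechet_derivative_at[symmetric])
  then show "Ck_on n UNIV (\<lambda>x. frechet_derivative h (at x) v)" using h'(2) by simp
qed

text \<open>As in the chain rule, a direction that varies with the point is reduced to the fixed
  basis directions.\<close>

lemma smooth_frechet_derivative_apply:
  fixes h :: "'a::euclidean_space \<Rightarrow> 'b::real_normed_vector"
  assumes "smooth_on UNIV h" "smooth_on UNIV w"
  shows "smooth_on UNIV (\<lambda>x. frechet_derivative h (at x) (w x))"
proof -
  have "frechet_derivative h (at x) (w x) = (\<Sum>b\<in>Basis. (w x \<bullet> b) *\<^sub>R frechet_derivative h (at x) b)" for x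
  proof -
    interpret bounded_linear "frechet_derivative h (at x)"
      using smooth_imp_has_derivative[OF assms(1)] by (rule has_derivative_bounded_linear)
    have "frechet_derivative h (at x) (w x)
        = frechet_derivative h (at x) (\<Sum>b\<in>Basis. (w x \<bullet> b) *\<^sub>R b)"
      by (simp add: euclidean_representation)
    then show ?thesis by (simp add: sum scaleR)
  qed
  then show ?thesis by (simp add: smooth_intros smooth_frechet_derivative[OF assms(1)] assms(2))
qed

text \<open>The result is a substitution and not a multiplier: composing with it extends a function
  given on (0, r] smoothly to all real radii and leaves it unchanged on the middle interval.\<close>

lemma smooth_cutoff:
  assumes "\<epsilon> > 0" "\<epsilon> < r / 2"
  obtains \<theta> :: "real \<Rightarrow> real" where "smooth_on UNIV \<theta>" "\<And>x. \<theta> x \<in> {0<..<r}"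
    "\<And>x. x \<in> {\<epsilon>..r - \<epsilon>} \<Longrightarrow> \<theta> x = x"
proof -
  define p where "p x = x * (r - x)" for x
  define m where "m = p \<epsilon>"
  have m: "m > 0" using assms by (simp add: m_def p_def)
  have den: "flat 0 x + flat 0 (m - x) > 0" for x
    using m by (auto simp: flat_def add_pos_pos)
  \<comment> \<open>A smooth step in the level \<open>p x\<close>: it is 0 for
    \<open>p x \<le> 0\<close> and 1 for \<open>p x \<ge> m\<close>, that is, from \<epsilon> to r -
    \<epsilon>. The exponent -1 is the reciprocal in the form covered by
    \<open>smooth_on_powr\<close>. Below, \<open>\<theta>\<close> uses this weight to interpolate
    between x and the midpoint of the interval.\<close>
  define step where "step x = flat 0 (p x) * (flat 0 (p x) + flat 0 (m - p x)) powr (- 1)" for x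
  define \<theta> where "\<theta> x = step x * x + (1 - step x) * (r / 2)" for x
  have flat: "smooth_on UNIV (flat 0)" by (simp add: smooth_on_def Ck_on_flat)
  have p: "smooth_on UNIV p" unfolding p_def by (intro smooth_intros)
  have fp: "smooth_on UNIV (\<lambda>x. flat 0 (p x))" "smooth_on UNIV (\<lambda>x. flat 0 (m - p x))"
    by (rule smooth_on_compose_UNIV[OF flat], intro smooth_intros p)+
  have "smooth_on UNIV (\<lambda>x. (flat 0 (p x) + flat 0 (m - p x)) powr (- 1))"
    by (rule smooth_on_compose[OF smooth_on_powr]) (auto intro!: smooth_intros fp simp: den)
  then have step: "smooth_on UNIV step" unfolding step_def by (intro smooth_intros fp)
  show ?thesis
  proof
    show "smooth_on UNIV \<theta>" unfolding \<theta>_def by (intro smooth_intros step)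
    show "\<theta> x \<in> {0<..<r}" for x
    proof (cases "p x > 0")
      case True
      then have x: "0 < x" "x < r" using assms by (auto simp: p_def zero_less_mult_iff)
      have "flat 0 y \<ge> 0" for y by (simp add: flat_def)
      then have "0 \<le> step x" "step x \<le> 1"
        using den[of "p x"] by (auto simp: step_def powr_minus field_simps)
      then have "\<theta> x \<in> closed_segment (r / 2) x"
        unfolding in_segment by (intro exI[of _ "step x"]) (simp add: \<theta>_def)
      moreover have "closed_segment (r / 2) x \<subseteq> {0<..<r}"
        using x by (intro closed_segment_subset) auto
      ultimately show ?thesis by blast
    next
      case False
      then show ?thesis using assms by (simp add: \<theta>_def step_def flat_def)
    qed
    show "\<theta> x = x" if "x \<in> {\<epsilon>..r - \<epsilon>}" for x
    proof -
      have "0 \<le> (x - \<epsilon>) * (r - \<epsilon> - x)" using that by simp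
      then have "p x \<ge> m" by (simp add: p_def m_def algebra_simps)
      then have "step x = 1"
        using m by (simp add: step_def flat_def powr_minus field_simps)
      then show ?thesis by (simp add: \<theta>_def)
    qed
  qed
qed

section \<open>Division by a variable and averaging\<close>

text \<open>This is \<open>(f (x, t) - f (x, 0)) / t\<close> in a form that stays smooth at t = 0.
  With the derivative of the slice in place of \<open>frechet_derivative\<close>, the value depends
  on f only through its slice at x, so periodicity passes to the quotient by congruence.\<close>

definition hadamard_quotient :: "('a \<times> real \<Rightarrow> 'b::real_normed_vector) \<Rightarrow> 'a \<times> real \<Rightarrow> 'b" where
  "hadamard_quotient f z =
     integral {0..1} (\<lambda>\<tau>. vector_derivative (\<lambda>s. f (fst z, s)) (at (\<tau> * snd z)))"

lemma smooth_has_vector_derivative_snd: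
  fixes f :: "'a::real_normed_vector \<times> real \<Rightarrow> 'b::real_normed_vector"
  assumes "smooth_on UNIV f"
  shows "((\<lambda>s. f (x, s)) has_vector_derivative frechet_derivative f (at (x, r)) (0, 1)) (at r)"
proof -
  have d: "(f has_derivative frechet_derivative f (at (x, r))) (at (x, r))"
    by (rule smooth_imp_has_derivative[OF assms])
  interpret bounded_linear "frechet_derivative f (at (x, r))"
    using d by (rule has_derivative_bounded_linear)
  have "((\<lambda>s. (x, s)) has_derivative (\<lambda>v. (0, v))) (at r)"
    by (auto intro!: derivative_eq_intros)
  from has_derivative_compose[OF this d]
  have "((\<lambda>s. f (x, s)) has_derivative (\<lambda>v. frechet_derivative f (at (x, r)) (0, v))) (at r)" .
  moreover have "(\<lambda>v. frechet_derivative f (at (x, r)) (0, v)) =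
      (\<lambda>v. v *\<^sub>R frechet_derivative f (at (x, r)) (0, 1))"
  proof
    fix v
    show "frechet_derivative f (at (x, r)) (0, v) = v *\<^sub>R frechet_derivative f (at (x, r)) (0, 1)"
      using scaleR[of v "(0, 1)"] by simp
  qed
  ultimately show ?thesis unfolding has_vector_derivative_def by (rule has_derivative_eq_rhs)
qed

lemma hadamard_quotient_cong:
  "(\<And>s. f (x, s) = f (y, s)) \<Longrightarrow> hadamard_quotient f (x, t) = hadamard_quotient f (y, t)"
  by (simp add: hadamard_quotient_def)

lemma hadamard_quotient_const:
  "(\<And>s. f (x, s) = c) \<Longrightarrow> hadamard_quotient f (x, t) = 0"
  by (simp add: hadamard_quotient_def)

lemma smooth_hadamard_quotient:
  fixes f :: "'a::euclidean_space \<times> real \<Rightarrow> 'b::euclidean_space"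
  assumes "smooth_on UNIV f"
  shows "smooth_on UNIV (hadamard_quotient f)"
proof -
  have "smooth_on UNIV (\<lambda>w. frechet_derivative f (at (fst (fst w), snd w * snd (fst w))) (0, 1))"
    by (rule smooth_on_compose_UNIV[OF smooth_frechet_derivative[OF assms]]) (intro smooth_intros)
  then have "smooth_on UNIV (\<lambda>z. integral {0..1} (\<lambda>\<tau>.
      frechet_derivative f (at (fst (fst (z, \<tau>)), snd (z, \<tau>) * snd (fst (z, \<tau>)))) (0, 1)))"
    by (rule smooth_on_integral)
  moreover have "hadamard_quotient f = (\<lambda>z. integral {0..1} (\<lambda>\<tau>.
      frechet_derivative f (at (fst (fst (z, \<tau>)), snd (z, \<tau>) * snd (fst (z, \<tau>)))) (0, 1)))"
    unfolding hadamard_quotient_def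
    by (simp add: vector_derivative_at[OF smooth_has_vector_derivative_snd[OF assms]])
  ultimately show ?thesis by simp
qed

text \<open>The fundamental theorem of calculus for \<open>f (x, \<tau> * t)\<close>, with \<tau>
  running from 0 to 1.\<close>

lemma hadamard_quotient_eq:
  fixes f :: "'a::euclidean_space \<times> real \<Rightarrow> 'b::euclidean_space"
  assumes "smooth_on UNIV f"
  shows "f (x, t) = f (x, 0) + t *\<^sub>R hadamard_quotient f (x, t)"
proof -
  let ?d = "\<lambda>r. frechet_derivative f (at (x, r)) (0, 1)"
  have "((\<lambda>\<tau>. f (x, \<tau> * t)) has_vector_derivative t *\<^sub>R ?d (\<tau> * t)) (at \<tau> within {0..1})" for \<tau>
  proof -
    have "((\<lambda>\<tau>. \<tau> * t) has_vector_derivative t) (at \<tau>)"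
      by (auto intro!: derivative_eq_intros)
    from vector_diff_chain_at[OF this smooth_has_vector_derivative_snd[OF assms]]
    show ?thesis by (auto simp: o_def intro: has_vector_derivative_at_within)
  qed
  from fundamental_theorem_of_calculus[OF _ this]
  have "((\<lambda>\<tau>. t *\<^sub>R ?d (\<tau> * t)) has_integral f (x, t) - f (x, 0)) {0..1}" by simp
  then have "f (x, t) - f (x, 0) = t *\<^sub>R integral {0..1} (\<lambda>\<tau>. ?d (\<tau> * t))"
    by (metis integral_cmul integral_unique)
  then show ?thesis
    by (simp add: hadamard_quotient_def algebra_simps
        vector_derivative_at[OF smooth_has_vector_derivative_snd[OF assms]])
qed

text \<open>The integral of h (x, .) from 0 to s, rescaled to the unit interval: smoothness in s
  reduces to \<open>smooth_on_integral\<close>, and negative s is no separate case.\<close>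

definition primitive :: "('a \<times> real \<Rightarrow> 'b::real_normed_vector) \<Rightarrow> 'a \<times> real \<Rightarrow> 'b" where
  "primitive h z = snd z *\<^sub>R integral {0..1} (\<lambda>\<tau>. h (fst z, \<tau> * snd z))"

lemma smooth_primitive:
  fixes h :: "'a::euclidean_space \<times> real \<Rightarrow> 'b::euclidean_space"
  assumes "smooth_on UNIV h"
  shows "smooth_on UNIV (primitive h)"
proof -
  have "smooth_on UNIV (\<lambda>w. h (fst (fst w), snd w * snd (fst w)))"
    by (rule smooth_on_compose_UNIV[OF assms]) (intro smooth_intros)
  from smooth_on_integral[OF this] show ?thesis
    unfolding primitive_def by (auto intro!: smooth_intros)
qed

lemma primitive_has_vector_derivative:
  fixes h :: "'a::euclidean_space \<times> real \<Rightarrow> 'b::euclidean_space"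
  assumes "continuous_on UNIV h"
  shows "((\<lambda>s. primitive h (x, s)) has_vector_derivative h (x, t)) (at t)"
proof -
  \<comment> \<open>The margin 1 makes t interior to the interval on which an antiderivative is
    chosen; there \<open>primitive\<close> agrees with it up to a constant.\<close>
  define m where "m = \<bar>t\<bar> + 1"
  have "continuous_on {-m..m} (\<lambda>s. h (x, s))"
    by (intro continuous_on_compose2[OF assms] continuous_intros) auto
  then obtain g where g: "\<And>s. s \<in> {-m..m} \<Longrightarrow>
      (g has_vector_derivative h (x, s)) (at s within {-m..m})"
    using antiderivative_continuous by blast
  have eq: "primitive h (x, s) = g s - g 0" if s: "s \<in> {-m<..<m}" for s
  proof -
    have "((\<lambda>\<tau>. g (\<tau> * s)) has_vector_derivative s *\<^sub>R h (x, \<tau> * s)) (at \<tau> within {0..1})"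
      if \<tau>: "\<tau> \<in> {0..1}" for \<tau>
    proof -
      have sub: "(\<lambda>\<tau>. \<tau> * s) ` {0..1} \<subseteq> {-m..m}"
      proof
        fix y assume "y \<in> (\<lambda>\<tau>. \<tau> * s) ` {0..1}"
        then obtain \<tau>' where "y = \<tau>' * s" "\<tau>' \<in> {0..1}" by blast
        then have "\<bar>y\<bar> \<le> 1 * \<bar>s\<bar>"
          unfolding abs_mult \<open>y = \<tau>' * s\<close> by (intro mult_right_mono) auto
        with s show "y \<in> {-m..m}" by auto
      qed
      then have "(g has_vector_derivative h (x, \<tau> * s)) (at (\<tau> * s) within (\<lambda>\<tau>. \<tau> * s) ` {0..1})"
        using \<tau> by (intro has_vector_derivative_within_subset[OF g]) blast+
      moreover have "((\<lambda>\<tau>. \<tau> * s) has_vector_derivative s) (at \<tau> within {0..1})"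
        by (auto intro!: derivative_eq_intros)
      ultimately show ?thesis
        using vector_diff_chain_within[of "\<lambda>\<tau>. \<tau> * s" s \<tau> "{0..1}" g "h (x, \<tau> * s)"]
        by (simp add: o_def)
    qed
    from fundamental_theorem_of_calculus[OF _ this]
    have "((\<lambda>\<tau>. s *\<^sub>R h (x, \<tau> * s)) has_integral g s - g 0) {0..1}" by simp
    then show ?thesis
      by (simp add: primitive_def) (metis integral_cmul integral_unique)
  qed
  have t: "t \<in> {-m<..<m}" by (auto simp: m_def)
  then have "(g has_vector_derivative h (x, t)) (at t)"
    using has_vector_derivative_within_subset[OF g, of t "{-m<..<m}"]
    by (auto simp: at_within_open[of t "{-m<..<m}"] subset_iff)
  then have "((\<lambda>s. g s - g 0) has_vector_derivative h (x, t)) (at t)"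
    by (auto intro!: derivative_eq_intros)
  then show ?thesis
    by (rule has_vector_derivative_transform_within_open[of _ _ _ "{-m<..<m}"]) (use t eq in auto)
qed

section \<open>Periodicity and the homological equation\<close>

lemma frechet_derivative_periodic:
  assumes "smooth_on UNIV h" and "\<And>x. h (x + q) = h x"
  shows "frechet_derivative h (at (x + q)) = frechet_derivative h (at x)"
proof -
  have "((\<lambda>x. x + q) has_derivative (\<lambda>v. v)) (at x)" by (auto intro!: derivative_eq_intros)
  from has_derivative_compose[OF this smooth_imp_has_derivative[OF assms(1)]]
  have "(h has_derivative frechet_derivative h (at (x + q))) (at x)" by (simp add: assms(2))
  then show ?thesis by (rule frechet_derivative_at)
qed

text \<open>Here p is a period in the slow variable Z and P one in the fast phase \<sigma>. The
  nesting \<open>((Z, \<sigma>), \<mu>)\<close> puts \<mu> last for Hadamard quotients and, after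
  \<mu> = 0 is inserted, \<sigma> last for primitives.\<close>

definition biperiodic :: "'a::plus \<Rightarrow> real \<Rightarrow> (('a \<times> real) \<times> real \<Rightarrow> 'b) \<Rightarrow> bool" where
  "biperiodic p P F \<longleftrightarrow>
     (\<forall>Z \<sigma> \<mu>. F ((Z + p, \<sigma>), \<mu>) = F ((Z, \<sigma>), \<mu>) \<and> F ((Z, \<sigma> + P), \<mu>) = F ((Z, \<sigma>), \<mu>))"

lemma biperiodicD:
  assumes "biperiodic p P F"
  shows "F ((Z + p, \<sigma>), \<mu>) = F ((Z, \<sigma>), \<mu>)" "F ((Z, \<sigma> + P), \<mu>) = F ((Z, \<sigma>), \<mu>)"
  using assms by (auto simp: biperiodic_def)

text \<open>With l the mean of e over one period in \<sigma>, the right-hand side has mean zero in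
  \<sigma>, which is what makes its primitive periodic.\<close>

lemma homological_equation:
  fixes e :: "'a::euclidean_space \<times> real \<Rightarrow> 'b::euclidean_space"
  assumes e: "smooth_on UNIV e" and "\<And>Z \<sigma>. e (Z + p, \<sigma>) = e (Z, \<sigma>)" "\<And>Z \<sigma>. e (Z, \<sigma> + P) = e (Z, \<sigma>)"
    and "P \<noteq> 0" "s\<^sub>0 \<noteq> 0"
  obtains l u where "smooth_on UNIV l" "\<And>Z. l (Z + p) = l Z" "smooth_on UNIV u"
    "\<And>Z \<sigma>. u (Z + p, \<sigma>) = u (Z, \<sigma>)" "\<And>Z \<sigma>. u (Z, \<sigma> + P) = u (Z, \<sigma>)"
    "\<And>Z \<sigma>. frechet_derivative u (at (Z, \<sigma>)) (0, s\<^sub>0) = l Z - e (Z, \<sigma>)"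
proof -
  define l where "l Z = integral {0..1} (\<lambda>\<tau>. e (Z, \<tau> * P))" for Z
  define u where "u y = (1 / s\<^sub>0) *\<^sub>R (snd y *\<^sub>R l (fst y) - primitive e y)" for y
  have "smooth_on UNIV (\<lambda>w. e (fst w, snd w * P))"
    by (rule smooth_on_compose_UNIV[OF e]) (intro smooth_intros)
  from smooth_on_integral[OF this] have l: "smooth_on UNIV l" by (simp add: l_def[abs_def])
  have lp: "l (Z + p) = l Z" for Z by (simp add: l_def assms)
  have u: "smooth_on UNIV u" unfolding u_def
    by (intro smooth_intros smooth_primitive e smooth_on_compose_UNIV[OF l])
  have up: "u (Z + p, \<sigma>) = u (Z, \<sigma>)" for Z \<sigma> by (simp add: u_def lp primitive_def assms)
  have du: "((\<lambda>s. u (Z, s)) has_vector_derivative (1 / s\<^sub>0) *\<^sub>R (l Z - e (Z, \<sigma>))) (at \<sigma>)" for Z \<sigma>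
    unfolding u_def
    by (auto intro!: derivative_eq_intros
        primitive_has_vector_derivative[OF smooth_on_imp_continuous_on[OF e]])
  \<comment> \<open>The increment of u over one period does not depend on \<sigma>, and at \<sigma>
    = 0 it vanishes because l is the mean.\<close>
  have "u (Z, \<sigma> + P) = u (Z, \<sigma>)" for Z \<sigma>
  proof -
    have "((\<lambda>s. u (Z, s + P) - u (Z, s)) has_vector_derivative 0) (at s)" for s
    proof -
      have "((\<lambda>s. s + P) has_vector_derivative 1) (at s)" by (auto intro!: derivative_eq_intros)
      from vector_diff_chain_at[OF this du]
      have "((\<lambda>s. u (Z, s + P)) has_vector_derivative (1 / s\<^sub>0) *\<^sub>R (l Z - e (Z, s))) (at s)"
        by (simp add: o_def assms)
      from has_vector_derivative_diff[OF this du[of Z s]] show ?thesis by simp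
    qed
    then obtain c where c: "\<And>s. u (Z, s + P) - u (Z, s) = c"
      using has_vector_derivative_zero_constant[of UNIV "\<lambda>s. u (Z, s + P) - u (Z, s)"] by auto
    then have "u (Z, \<sigma> + P) - u (Z, \<sigma>) = u (Z, 0 + P) - u (Z, 0)"
      by (simp only: c)
    also have "\<dots> = 0" by (simp add: u_def primitive_def l_def)
    finally show ?thesis by simp
  qed
  moreover have "frechet_derivative u (at (Z, \<sigma>)) (0, s\<^sub>0) = l Z - e (Z, \<sigma>)" for Z \<sigma>
  proof -
    interpret bounded_linear "frechet_derivative u (at (Z, \<sigma>))"
      using smooth_imp_has_derivative[OF u] by (rule has_derivative_bounded_linear)
    have "frechet_derivative u (at (Z, \<sigma>)) (0, s\<^sub>0)
        = s\<^sub>0 *\<^sub>R frechet_derivative u (at (Z, \<sigma>)) (0, 1)"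
      using scaleR[of s\<^sub>0 "(0, 1)"] by simp
    also have "frechet_derivative u (at (Z, \<sigma>)) (0, 1) = (1 / s\<^sub>0) *\<^sub>R (l Z - e (Z, \<sigma>))"
      using vector_derivative_unique_at[OF smooth_has_vector_derivative_snd[OF u] du] .
    finally show ?thesis using assms(5) by simp
  qed
  ultimately show ?thesis using that l lp u up by blast
qed

section \<open>Formal normal form\<close>

text \<open>
  With \<open>x = ((Z, \<sigma>), \<mu>)\<close>, the defect of \<open>z = Z + U x\<close> as a conjugation, along
  \<open>Z' = G x\<close>, \<open>\<sigma>' = a \<mu>\<close>, \<open>\<mu>' = b \<mu>\<close>, to \<open>z' = (\<Sum>k=1..n. \<mu>^k *\<^sub>R l k z)\<close>.
\<close>

definition conj_defect ::
    "(('a::real_normed_vector \<times> real) \<times> real \<Rightarrow> 'a) \<Rightarrow> (real \<Rightarrow> real) \<Rightarrow> (real \<Rightarrow> real) \<Rightarrow>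
     (('a \<times> real) \<times> real \<Rightarrow> 'a) \<Rightarrow> (nat \<Rightarrow> 'a \<Rightarrow> 'a) \<Rightarrow> nat \<Rightarrow> ('a \<times> real) \<times> real \<Rightarrow> 'a" where
  "conj_defect G a b U l n x =
     G x + frechet_derivative U (at x) ((G x, a (snd x)), b (snd x))
     - (\<Sum>k=1..n. snd x ^ k *\<^sub>R l k (fst (fst x) + U x))"

text \<open>
  Induction on the order: the defect is \<open>\<mu>^(n+1) *\<^sub>R H\<close>, and the next term of the transformation
  solves the homological equation for \<open>H\<close> at \<open>\<mu> = 0\<close>. What is left after taking out \<open>\<mu>^(n+1)\<close>
  vanishes at \<open>\<mu> = 0\<close>, so another factor \<open>\<mu>\<close> can be divided out.
\<close>

lemma normal_form:
  fixes G :: "('a::euclidean_space \<times> real) \<times> real \<Rightarrow> 'a"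
  assumes G: "smooth_on UNIV G" "biperiodic p P G" "\<And>y. G (y, 0) = 0"
    and a: "smooth_on UNIV a" "a 0 = s\<^sub>0" "s\<^sub>0 \<noteq> 0"
    and b: "\<And>\<mu>. b \<mu> = \<mu> * \<mu> * c \<mu>" "smooth_on UNIV c"
    and P: "P \<noteq> 0"
  shows "\<exists>V l H. smooth_on UNIV V \<and> biperiodic p P V \<and> smooth_on UNIV H \<and> biperiodic p P H \<and>
    (\<forall>k. smooth_on UNIV (l k) \<and> (\<forall>Z. l k (Z + p) = l k Z)) \<and>
    (\<forall>x. conj_defect G a b (\<lambda>x. snd x *\<^sub>R V x) l n x = snd x ^ (n + 1) *\<^sub>R H x)"
proof (induction n)
  case 0
  show ?case
  \<comment> \<open>Without any transformation the defect is G itself, and G vanishes at \<mu> =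
    0.\<close>
  proof (rule exI[of _ "\<lambda>x. 0"], rule exI[of _ "\<lambda>k x. 0"], rule exI[of _ "hadamard_quotient G"],
      intro conjI allI)
    show "smooth_on UNIV (hadamard_quotient G)" by (rule smooth_hadamard_quotient[OF G(1)])
    show "biperiodic p P (hadamard_quotient G)"
      unfolding biperiodic_def
      by (intro allI conjI hadamard_quotient_cong) (simp_all add: biperiodicD[OF G(2)])
    show "smooth_on UNIV (\<lambda>x::('a \<times> real) \<times> real. 0::'a)" "smooth_on UNIV (\<lambda>x::'a. 0::'a)"
      by (rule smooth_on_const)+
    show "biperiodic p P (\<lambda>x. 0)" by (simp add: biperiodic_def)
    show "conj_defect G a b (\<lambda>x. snd x *\<^sub>R 0) (\<lambda>k x. 0) 0 x
        = snd x ^ (0 + 1) *\<^sub>R hadamard_quotient G x" for x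
      using hadamard_quotient_eq[OF G(1), of "fst x" "snd x"]
      by (simp add: conj_defect_def G(3))
  qed simp
next
  case (Suc n)
  then obtain V l H where V: "smooth_on UNIV V" "biperiodic p P V"
    and H: "smooth_on UNIV H" "biperiodic p P H"
    and l: "\<And>k. smooth_on UNIV (l k)" "\<And>k Z. l k (Z + p) = l k Z"
    and defect: "\<And>x. conj_defect G a b (\<lambda>x. snd x *\<^sub>R V x) l n x = snd x ^ (n + 1) *\<^sub>R H x"
    by blast
  define e where "e y = H (y, 0)" for y
  have "smooth_on UNIV e" unfolding e_def
    by (rule smooth_on_compose_UNIV[OF H(1)]) (intro smooth_intros)
  moreover have "e (Z + p, \<sigma>) = e (Z, \<sigma>)" "e (Z, \<sigma> + P) = e (Z, \<sigma>)" for Z \<sigma>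
    by (simp_all add: e_def biperiodicD[OF H(2)])
  ultimately obtain m u where m: "smooth_on UNIV m" "\<And>Z. m (Z + p) = m Z"
    and u: "smooth_on UNIV u" "\<And>Z \<sigma>. u (Z + p, \<sigma>) = u (Z, \<sigma>)" "\<And>Z \<sigma>. u (Z, \<sigma> + P) = u (Z, \<sigma>)"
    and hom: "\<And>Z \<sigma>. frechet_derivative u (at (Z, \<sigma>)) (0, s\<^sub>0) = m Z - e (Z, \<sigma>)"
    using homological_equation[of e p P s\<^sub>0] P a(3) by blast
  define U where "U x = snd x *\<^sub>R V x" for x
  define V' where "V' x = V x + snd x ^ n *\<^sub>R u (fst x)" for x
  define U' where "U' x = snd x *\<^sub>R V' x" for x
  \<comment> \<open>The additional last variable interpolates: at 0 it gives the old averaged terms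
    at Z + U x, at \<mu>^(n+1) the same terms at Z + U' x. Their difference is therefore \<mu>^(n+1)
    times the smooth function \<open>Q\<close>.\<close>
  define f where "f w = (\<Sum>k=1..n. snd (fst w) ^ k *\<^sub>R
      l k (fst (fst (fst w)) + U (fst w) + snd w *\<^sub>R u (fst (fst w))))" for w
  define Q where "Q x = hadamard_quotient f (x, snd x ^ (n + 1))" for x
  define D where "D x = frechet_derivative u (at (fst x)) (G x, a (snd x))" for x
  \<comment> \<open>What the new defect leaves after \<mu>^(n+1) is taken out. The second summand
    comes from differentiating \<mu>^(n+1) along \<open>b\<close>; because
    \<open>b \<mu> = \<mu> * \<mu> * c \<mu>\<close>, it retains a factor \<mu>.\<close>
  define K where "K x = H x + (real (n + 1) * (snd x * c (snd x))) *\<^sub>R u (fst x) + D x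
      - Q x - m (fst (fst x) + U' x)" for x
  define l' where "l' = l(Suc n := m)"
  have U: "smooth_on UNIV U" unfolding U_def by (intro smooth_intros V)
  have ufst: "smooth_on UNIV (\<lambda>x. u (fst x))"
    by (rule smooth_on_compose_UNIV[OF u(1)]) (intro smooth_intros)
  have V': "smooth_on UNIV V'" unfolding V'_def by (intro smooth_intros V ufst)
  have U': "smooth_on UNIV U'" unfolding U'_def by (intro smooth_intros V')
  have U'_eq: "U' x = U x + snd x ^ (n + 1) *\<^sub>R u (fst x)" for x
    by (simp add: U'_def V'_def U_def algebra_simps)
  have f: "smooth_on UNIV f" unfolding f_def
    by (intro smooth_intros smooth_on_compose_UNIV[OF l(1)] smooth_on_compose_UNIV[OF U]
        smooth_on_compose_UNIV[OF u(1)])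
  have Q: "smooth_on UNIV Q" unfolding Q_def
    by (intro smooth_on_compose_UNIV[OF smooth_hadamard_quotient[OF f]] smooth_intros)
  have D: "smooth_on UNIV D"
  proof -
    \<comment> \<open>Both the base point and the direction in \<open>D\<close> depend on x; read as
      a derivative of \<open>\<lambda>x. u (fst x)\<close> at x itself, \<open>D\<close> falls under
      \<open>smooth_frechet_derivative_apply\<close>.\<close>
    have "smooth_on UNIV (\<lambda>x. frechet_derivative (\<lambda>x. u (fst x)) (at x) ((G x, a (snd x)), 0))"
      by (intro smooth_frechet_derivative_apply ufst smooth_intros G smooth_on_compose_UNIV[OF a(1)])
    moreover have "frechet_derivative (\<lambda>x. u (fst x)) (at x) ((G x, a (snd x)), 0) = D x" for x
    proof -
      have "((\<lambda>x. u (fst x)) has_derivative (\<lambda>v. frechet_derivative u (at (fst x)) (fst v))) (at x)"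
        by (rule has_derivative_compose[OF _ smooth_imp_has_derivative[OF u(1)]])
          (auto intro!: derivative_eq_intros)
      from frechet_derivative_at[OF this, symmetric] show ?thesis by (simp add: D_def)
    qed
    ultimately show ?thesis by simp
  qed
  have K: "smooth_on UNIV K" unfolding K_def
    by (intro smooth_intros H D Q ufst smooth_on_compose_UNIV[OF b(2)]
        smooth_on_compose_UNIV[OF m(1)] U')
  have V'_per: "biperiodic p P V'"
    by (simp add: biperiodic_def V'_def biperiodicD[OF V(2)] u)
  have U_per: "biperiodic p P U"
    by (simp add: biperiodic_def U_def biperiodicD[OF V(2)])
  have U'_per: "biperiodic p P U'"
    by (simp add: biperiodic_def U'_def biperiodicD[OF V'_per])
  have shift: "l k (Z + (p + w)) = l k (Z + w)" "m (Z + (p + w)) = m (Z + w)" for k Z w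
    using l(2)[of k "Z + w"] m(2)[of "Z + w"] by (simp_all add: ac_simps)
  have Q_per: "biperiodic p P Q"
    unfolding biperiodic_def Q_def
    by (auto intro!: hadamard_quotient_cong
        simp: f_def biperiodicD[OF U_per] u shift add.assoc)
  have D_per: "biperiodic p P D"
  proof -
    have "frechet_derivative u (at (Z + p, \<sigma>)) = frechet_derivative u (at (Z, \<sigma>))"
      "frechet_derivative u (at (Z, \<sigma> + P)) = frechet_derivative u (at (Z, \<sigma>))" for Z \<sigma>
      using frechet_derivative_periodic[OF u(1), of "(p, 0)" "(Z, \<sigma>)"]
        frechet_derivative_periodic[OF u(1), of "(0, P)" "(Z, \<sigma>)"] u(2,3) by auto
    then show ?thesis by (simp add: biperiodic_def D_def biperiodicD[OF G(2)])
  qed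
  have K_per: "biperiodic p P K"
    by (simp add: biperiodic_def K_def biperiodicD[OF H(2)] biperiodicD[OF D_per] u
        biperiodicD[OF Q_per] biperiodicD[OF U'_per] shift add.assoc)
  \<comment> \<open>At \<mu> = 0 the field G and the averaged sum disappear, and the phase moves
    with speed \<open>s\<^sub>0\<close>. By the homological equation what is left is
    \<open>e + (m - e) - m\<close>.\<close>
  have K_0: "K (y, 0) = 0" for y
  proof -
    have "f ((y, 0), s) = 0" for s
      unfolding f_def by (rule sum.neutral) (simp add: power_0_left)
    then have "Q (y, 0) = 0" by (simp add: Q_def hadamard_quotient_const)
    then show ?thesis
      using hom[of "fst y" "snd y"] by (simp add: K_def D_def G(3) a(2) U'_def e_def)
  qed
  have dU': "frechet_derivative U' (at x) ((G x, a (snd x)), b (snd x)) =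
      frechet_derivative U (at x) ((G x, a (snd x)), b (snd x)) +
      snd x ^ (n + 1) *\<^sub>R (D x + (real (n + 1) * (snd x * c (snd x))) *\<^sub>R u (fst x))" for x
  proof -
    have pow: "((\<lambda>x. snd x ^ (n + 1)) has_derivative
        (\<lambda>v. real (n + 1) * (snd v * snd x ^ n))) (at x)" for x :: "('a \<times> real) \<times> real"
      by (rule has_derivative_eq_rhs[OF has_derivative_power[OF has_derivative_snd[OF has_derivative_ident]]])
        (simp add: fun_eq_iff)
    have "((\<lambda>x. u (fst x)) has_derivative (\<lambda>v. frechet_derivative u (at (fst x)) (fst v))) (at x)"
      by (rule has_derivative_compose[OF _ smooth_imp_has_derivative[OF u(1)]])
        (auto intro!: derivative_eq_intros)
    from has_derivative_add[OF smooth_imp_has_derivative[OF U] has_derivative_scaleR[OF pow this]]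
    have "(U' has_derivative (\<lambda>v. frechet_derivative U (at x) v +
        (snd x ^ (n + 1) *\<^sub>R frechet_derivative u (at (fst x)) (fst v) +
        (real (n + 1) * (snd v * snd x ^ n)) *\<^sub>R u (fst x)))) (at x)"
      by (simp add: U'_eq[abs_def])
    from frechet_derivative_at[OF this, symmetric]
    show ?thesis by (simp add: D_def b(1) algebra_simps)
  qed
  have sum: "(\<Sum>k=1..Suc n. snd x ^ k *\<^sub>R l' k (fst (fst x) + U' x)) =
      (\<Sum>k=1..n. snd x ^ k *\<^sub>R l k (fst (fst x) + U x)) +
      snd x ^ (n + 1) *\<^sub>R (Q x + m (fst (fst x) + U' x))" for x
  proof -
    have "(\<Sum>k=1..Suc n. snd x ^ k *\<^sub>R l' k (fst (fst x) + U' x)) =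
        (\<Sum>k=1..n. snd x ^ k *\<^sub>R l k (fst (fst x) + U' x)) + snd x ^ (n + 1) *\<^sub>R m (fst (fst x) + U' x)"
      by (simp add: l'_def)
    also have "(\<Sum>k=1..n. snd x ^ k *\<^sub>R l k (fst (fst x) + U' x)) = f (x, snd x ^ (n + 1))"
      by (simp add: f_def U'_eq add.assoc)
    also have "\<dots> = f (x, 0) + snd x ^ (n + 1) *\<^sub>R Q x"
      unfolding Q_def by (rule hadamard_quotient_eq[OF f])
    finally show ?thesis by (simp add: f_def scaleR_add_right)
  qed
  have "conj_defect G a b U' l' (Suc n) x = snd x ^ (Suc n + 1) *\<^sub>R hadamard_quotient K x" for x
  proof -
    have "conj_defect G a b U' l' (Suc n) x =
        conj_defect G a b U l n x + snd x ^ (n + 1) *\<^sub>R (K x - H x)"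
      unfolding conj_defect_def dU' sum K_def by (simp add: algebra_simps)
    also have "\<dots> = snd x ^ (n + 1) *\<^sub>R K x"
      using defect[of x] by (simp add: U_def[abs_def] algebra_simps)
    also have "K x = snd x *\<^sub>R hadamard_quotient K x"
      using hadamard_quotient_eq[OF K, of "fst x" "snd x"] by (simp add: K_0)
    finally show ?thesis by simp
  qed
  moreover have "biperiodic p P (hadamard_quotient K)"
    unfolding biperiodic_def
    by (intro allI conjI hadamard_quotient_cong) (simp_all add: biperiodicD[OF K_per])
  moreover have "smooth_on UNIV (l' k) \<and> (\<forall>Z. l' k (Z + p) = l' k Z)" for k
    by (simp add: l'_def l m)
  ultimately show ?case
    using V' V'_per smooth_hadamard_quotient[OF K] unfolding U'_def by blast
qed

section \<open>Bounds and near-identity maps\<close>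

lemma periodic_int_multiple:
  fixes h :: "real \<Rightarrow> 'b"
  assumes "\<And>x. h (x + P) = h x"
  shows "h (x + of_int n * P) = h x"
proof (induction n rule: int_induct[of _ 0])
  case (step1 i)
  then show ?case using assms[of "x + of_int i * P"] by (simp add: algebra_simps)
next
  case (step2 i)
  then show ?case using assms[of "x + of_int (i - 1) * P"] by (simp add: algebra_simps)
qed simp

lemma periodic_representative:
  fixes h :: "real \<Rightarrow> 'b"
  assumes "P > 0" "\<And>x. h (x + P) = h x"
  obtains y where "y \<in> {0..P}" "h y = h x"
proof
  let ?y = "x - of_int \<lfloor>x / P\<rfloor> * P"
  show "h ?y = h x" using periodic_int_multiple[of h P x "- \<lfloor>x / P\<rfloor>"] assms(2) by simp
  have "of_int \<lfloor>x / P\<rfloor> * P \<le> x / P * P" "x / P * P \<le> (of_int \<lfloor>x / P\<rfloor> + 1) * P"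
    using assms(1) by (intro mult_right_mono; linarith)+
  then show "?y \<in> {0..P}" using assms(1) by (auto simp: algebra_simps)
qed

text \<open>Periodicity moves \<Psi> and \<sigma> into one period each, so a bound over a compact
  cell suffices.\<close>

lemma biperiodic_bounded:
  fixes F :: "((real \<times> real) \<times> real) \<times> real \<Rightarrow> 'b::real_normed_vector"
  assumes F: "continuous_on UNIV F" "biperiodic (0, p) P F" and "p > 0" "P > 0"
  shows "\<exists>B\<ge>0. \<forall>R\<in>{a..b}. \<forall>\<Psi> \<sigma>. \<forall>\<mu>\<in>{0..1}. norm (F (((R, \<Psi>), \<sigma>), \<mu>)) \<le> B"
proof -
  define K where "K = ({a..b} \<times> {0..p}) \<times> {0..P} \<times> {0..1::real}"
  let ?F = "\<lambda>(Z, \<sigma>, \<mu>). F ((Z, \<sigma>), \<mu>)"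
  have "compact (?F ` K)" unfolding K_def
    by (intro compact_continuous_image compact_Times)
      (auto simp: case_prod_beta intro!: continuous_on_compose2[OF F(1)] continuous_intros)
  then obtain B where B: "\<And>x. x \<in> K \<Longrightarrow> norm (?F x) \<le> B"
    using compact_imp_bounded bounded_iff by (metis imageI)
  have "norm (F (((R, \<Psi>), \<sigma>), \<mu>)) \<le> max B 0" if "R \<in> {a..b}" "\<mu> \<in> {0..1}" for R \<Psi> \<sigma> \<mu>
  proof -
    obtain \<Psi>' where \<Psi>': "\<Psi>' \<in> {0..p}" "F (((R, \<Psi>'), \<sigma>), \<mu>) = F (((R, \<Psi>), \<sigma>), \<mu>)"
      using periodic_representative[of p "\<lambda>\<Psi>. F (((R, \<Psi>), \<sigma>), \<mu>)" \<Psi>] assms(3)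
        biperiodicD(1)[OF F(2), of "(R, _)"] by auto
    obtain \<sigma>' where \<sigma>': "\<sigma>' \<in> {0..P}" "F (((R, \<Psi>'), \<sigma>'), \<mu>) = F (((R, \<Psi>'), \<sigma>), \<mu>)"
      using periodic_representative[of P "\<lambda>\<sigma>. F (((R, \<Psi>'), \<sigma>), \<mu>)" \<sigma>] assms(4)
        biperiodicD(2)[OF F(2)] by auto
    show ?thesis using B[of "((R, \<Psi>'), \<sigma>', \<mu>)"] that \<Psi>' \<sigma>' by (auto simp: K_def)
  qed
  then show ?thesis by (intro exI[of _ "max B 0"]) auto
qed

lemma biperiodic_frechet_derivative:
  fixes F :: "('a::real_normed_vector \<times> real) \<times> real \<Rightarrow> 'b::real_normed_vector"
  assumes "smooth_on UNIV F" "biperiodic p P F"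
  shows "biperiodic p P (\<lambda>x. frechet_derivative F (at x) v)"
proof -
  have "F (x + ((p, 0), 0)) = F x" "F (x + ((0, P), 0)) = F x" for x
    using biperiodicD[OF assms(2), of "fst (fst x)" "snd (fst x)" "snd x"]
    by (simp_all add: plus_prod_def)
  note per = this[THEN frechet_derivative_periodic[OF assms(1)]]
  show ?thesis
    unfolding biperiodic_def
  proof (intro allI conjI)
    show "frechet_derivative F (at ((Z + p, \<sigma>), \<mu>)) v = frechet_derivative F (at ((Z, \<sigma>), \<mu>)) v"
      "frechet_derivative F (at ((Z, \<sigma> + P), \<mu>)) v = frechet_derivative F (at ((Z, \<sigma>), \<mu>)) v"
      for Z \<sigma> \<mu>
      using per[of "((Z, \<sigma>), \<mu>)"] by simp_all
  qed
qed

lemma biperiodic_derivative_bounded: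
  fixes F :: "((real \<times> real) \<times> real) \<times> real \<Rightarrow> 'b::real_normed_vector"
  assumes F: "smooth_on UNIV F" "biperiodic (0, p) P F" and "p > 0" "P > 0"
  shows "\<exists>B\<ge>0. \<forall>R\<in>{a..b}. \<forall>\<Psi> \<sigma>. \<forall>\<mu>\<in>{0..1}. \<forall>v.
    norm (frechet_derivative F (at (((R, \<Psi>), \<sigma>), \<mu>)) v) \<le> B * norm v"
proof -
  have "\<exists>B\<ge>0. \<forall>R\<in>{a..b}. \<forall>\<Psi> \<sigma>. \<forall>\<mu>\<in>{0..1}.
      norm (frechet_derivative F (at (((R, \<Psi>), \<sigma>), \<mu>)) i) \<le> B" for i
    by (rule biperiodic_bounded[OF smooth_on_imp_continuous_on[OF smooth_frechet_derivative[OF F(1)]]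
          biperiodic_frechet_derivative[OF F] assms(3,4)])
  then obtain B where B0: "\<And>i. B i \<ge> 0" and B: "\<And>i R \<Psi> \<sigma> \<mu>. R \<in> {a..b} \<Longrightarrow> \<mu> \<in> {0..1} \<Longrightarrow>
      norm (frechet_derivative F (at (((R, \<Psi>), \<sigma>), \<mu>)) i) \<le> B i"
    by metis
  have "norm (frechet_derivative F (at (((R, \<Psi>), \<sigma>), \<mu>)) v) \<le> (\<Sum>i\<in>Basis. B i) * norm v"
    if "R \<in> {a..b}" "\<mu> \<in> {0..1}" for R \<Psi> \<sigma> \<mu> v
  proof -
    let ?D = "frechet_derivative F (at (((R, \<Psi>), \<sigma>), \<mu>))"
    interpret bounded_linear ?D
      using smooth_imp_has_derivative[OF F(1)] by (rule has_derivative_bounded_linear)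
    have "?D v = ?D (\<Sum>i\<in>Basis. (v \<bullet> i) *\<^sub>R i)" by (simp only: euclidean_representation)
    also have "\<dots> = (\<Sum>i\<in>Basis. (v \<bullet> i) *\<^sub>R ?D i)" by (simp only: sum scaleR)
    also have "norm \<dots> \<le> (\<Sum>i\<in>Basis. norm v * B i)"
      using that B by (intro sum_norm_le) (auto intro!: mult_mono Basis_le_norm)
    finally show ?thesis by (simp add: sum_distrib_left mult.commute)
  qed
  then show ?thesis by (intro exI[of _ "\<Sum>i\<in>Basis. B i"]) (auto intro: sum_nonneg B0)
qed

text \<open>The mean value inequality in Z: the strip of radii with free angle is convex, and the
  derivative is bounded on it.\<close>

lemma biperiodic_lipschitz:
  fixes F :: "((real \<times> real) \<times> real) \<times> real \<Rightarrow> 'b::real_normed_vector"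
  assumes F: "smooth_on UNIV F" "biperiodic (0, p) P F" and "p > 0" "P > 0"
  shows "\<exists>B\<ge>0. \<forall>Z\<in>{a..b} \<times> UNIV. \<forall>Z'\<in>{a..b} \<times> UNIV. \<forall>\<sigma>. \<forall>\<mu>\<in>{0..1}.
    norm (F ((Z, \<sigma>), \<mu>) - F ((Z', \<sigma>), \<mu>)) \<le> B * norm (Z - Z')"
proof -
  obtain B where "B \<ge> 0" and B: "\<And>R \<Psi> \<sigma> \<mu> v. R \<in> {a..b} \<Longrightarrow> \<mu> \<in> {0..1} \<Longrightarrow>
      norm (frechet_derivative F (at (((R, \<Psi>), \<sigma>), \<mu>)) v) \<le> B * norm v"
    using biperiodic_derivative_bounded[OF assms] by metis
  have "norm (F ((Z, \<sigma>), \<mu>) - F ((Z', \<sigma>), \<mu>)) \<le> B * norm (Z - Z')"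
    if "Z \<in> {a..b} \<times> UNIV" "Z' \<in> {a..b} \<times> UNIV" "\<mu> \<in> {0..1}" for Z Z' \<sigma> \<mu>
  proof (rule differentiable_bound[OF _ _ _ that(1,2)])
    show "convex ({a..b} \<times> (UNIV :: real set))" by (intro convex_Times) auto
    fix Z :: "real \<times> real" assume Z: "Z \<in> {a..b} \<times> UNIV"
    have "((\<lambda>Z. ((Z, \<sigma>), \<mu>)) has_derivative (\<lambda>v. ((v, 0), 0))) (at Z)"
      by (auto intro!: derivative_eq_intros)
    from has_derivative_compose[OF this smooth_imp_has_derivative[OF F(1)]]
    show "((\<lambda>Z. F ((Z, \<sigma>), \<mu>)) has_derivative
        (\<lambda>v. frechet_derivative F (at ((Z, \<sigma>), \<mu>)) ((v, 0), 0))) (at Z within {a..b} \<times> UNIV)"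
      by (rule has_derivative_at_withinI)
    show "onorm (\<lambda>v. frechet_derivative F (at ((Z, \<sigma>), \<mu>)) ((v, 0), 0)) \<le> B"
      using B[of "fst Z" \<mu> "snd Z" \<sigma> "((_, 0), 0)"] Z that(3)
      by (intro onorm_bound \<open>B \<ge> 0\<close>) (auto simp: norm_Pair)
  qed
  with \<open>B \<ge> 0\<close> show ?thesis by blast
qed

section \<open>Near-identity maps and the curves they transform\<close>

lemma perturbed_identity_expansive:
  fixes u :: "'a::real_normed_vector \<Rightarrow> 'a"
  assumes "norm (u Z - u Z') \<le> norm (Z - Z') / 2"
  shows "norm (Z - Z') \<le> 2 * norm ((Z + u Z) - (Z' + u Z'))"
proof -
  have "Z - Z' = ((Z + u Z) - (Z' + u Z')) - (u Z - u Z')" by simp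
  then have "norm (Z - Z') \<le> norm ((Z + u Z) - (Z' + u Z')) + norm (u Z - u Z')"
    by (metis norm_triangle_ineq4)
  with assms show ?thesis by simp
qed

text \<open>Solutions of \<open>Z + u Z = z\<close> are fixed points of
  \<open>\<lambda>Z. z - u Z\<close>, a contraction with constant 1/2. It maps the closed strip of
  half-width d around the radius of z into itself because u is at most d there; the angle needs no
  control.\<close>

lemma perturbed_identity_surjective:
  fixes u :: "real \<times> real \<Rightarrow> real \<times> real"
  assumes sub: "{fst z - d..fst z + d} \<times> UNIV \<subseteq> D"
    and lip: "\<And>Z Z'. Z \<in> D \<Longrightarrow> Z' \<in> D \<Longrightarrow> norm (u Z - u Z') \<le> norm (Z - Z') / 2"
    and small: "\<And>Z. Z \<in> {fst z - d..fst z + d} \<times> UNIV \<Longrightarrow> norm (u Z) \<le> d" and "d \<ge> 0"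
  obtains Z where "Z \<in> {fst z - d..fst z + d} \<times> UNIV" "Z + u Z = z"
proof -
  let ?A = "{fst z - d..fst z + d} \<times> (UNIV :: real set)"
  have "\<exists>!Z\<in>?A. z - u Z = Z"
  proof (rule Banach_fix[where c = "1 / 2"])
    show "complete ?A" by (simp add: complete_eq_closed closed_Times)
    show "?A \<noteq> {}" using \<open>d \<ge> 0\<close> by auto
    show "(\<lambda>Z. z - u Z) ` ?A \<subseteq> ?A"
    proof (intro image_subsetI)
      fix Z assume "Z \<in> ?A"
      then have "\<bar>fst (u Z)\<bar> \<le> d" using small[of Z] norm_fst_le[of "fst (u Z)" "snd (u Z)"] by auto
      then show "z - u Z \<in> ?A" by (auto simp: mem_Times_iff)
    qed
    show "dist (z - u Z) (z - u Z') \<le> 1 / 2 * dist Z Z'" if "Z \<in> ?A" "Z' \<in> ?A" for Z Z'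
      using lip[of Z Z'] that sub by (auto simp: dist_norm norm_minus_commute)
  qed auto
  then obtain Z where "Z \<in> ?A" "z - u Z = Z" by blast
  then show ?thesis using that[of Z] by (metis diff_add_cancel add.commute)
qed

text \<open>
  For the converse, compare \<open>Z\<close> with its expected tangent line \<open>c\<close> at \<open>s\<close>: the images of both
  under the expansive map agree to first order.
\<close>

lemma has_vector_derivative_transform_iff:
  fixes Z :: "real \<Rightarrow> 'a::real_normed_vector" and u :: "'a \<times> real \<Rightarrow> 'a"
  assumes u: "(u has_derivative D) (at (Z s, s))" and s: "s \<in> T"
    and E: "open E" "Z s \<in> E"
    and expansive: "\<And>t X. t \<in> T \<Longrightarrow> X \<in> E \<Longrightarrow> norm (Z t - X) \<le> 2 * norm ((Z t + u (Z t, t)) - (X + u (X, t)))"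
  shows "(Z has_vector_derivative w) (at s within T) \<longleftrightarrow>
    ((\<lambda>t. Z t + u (Z t, t)) has_vector_derivative w + D (w, 1)) (at s within T)"
proof -
  have lin: "bounded_linear D" using u by (rule has_derivative_bounded_linear)
  have chain: "((\<lambda>t. X t + u (X t, t)) has_vector_derivative w + D (w, 1)) (at s within T)"
    if X: "(X has_vector_derivative w) (at s within T)" and Xs: "X s = Z s" for X
  proof -
    interpret bounded_linear D by (rule lin)
    have "((\<lambda>t. (X t, t)) has_derivative (\<lambda>h. (h *\<^sub>R w, h))) (at s within T)"
      using X unfolding has_vector_derivative_def by (auto intro!: derivative_eq_intros)
    moreover have "(u has_derivative D) (at (X s, s))" using u Xs by simp
    ultimately have "((\<lambda>t. u (X t, t)) has_derivative (\<lambda>h. D (h *\<^sub>R w, h))) (at s within T)"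
      by (rule has_derivative_compose)
    moreover have "(\<lambda>h. D (h *\<^sub>R w, h)) = (\<lambda>h. h *\<^sub>R D (w, 1))"
    proof
      show "D (h *\<^sub>R w, h) = h *\<^sub>R D (w, 1)" for h using scaleR[of h "(w, 1)"] by simp
    qed
    ultimately have "((\<lambda>t. u (X t, t)) has_vector_derivative D (w, 1)) (at s within T)"
      unfolding has_vector_derivative_def by simp
    then show ?thesis using X by (rule has_vector_derivative_add[rotated])
  qed
  show ?thesis
  proof
    assume "(Z has_vector_derivative w) (at s within T)"
    then show "((\<lambda>t. Z t + u (Z t, t)) has_vector_derivative w + D (w, 1)) (at s within T)"
      by (rule chain) simp
  next
    assume z: "((\<lambda>t. Z t + u (Z t, t)) has_vector_derivative w + D (w, 1)) (at s within T)"
    define c where "c t = Z s + (t - s) *\<^sub>R w" for t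
    define h where "h t = (Z t + u (Z t, t)) - (c t + u (c t, t))" for t
    have c: "(c has_vector_derivative w) (at s within T)"
      unfolding c_def by (auto intro!: derivative_eq_intros)
    have cs: "c s = Z s" by (simp add: c_def)
    from has_vector_derivative_diff[OF z chain[OF c cs]]
    have "(h has_vector_derivative 0) (at s within T)" by (simp add: h_def[abs_def])
    then have lim: "((\<lambda>t. (1 / norm (t - s)) *\<^sub>R h t) \<longlongrightarrow> 0) (at s within T)"
      by (simp add: has_vector_derivative_def has_derivative_within h_def cs)
    \<comment> \<open>Expansiveness is available for points X of \<open>E\<close>; near s the line
      \<open>c\<close> stays in this open set.\<close>
    have "((\<lambda>t. c t) \<longlongrightarrow> c s) (at s within T)"
      using has_derivative_continuous[OF c[unfolded has_vector_derivative_def]]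
      by (simp add: continuous_within)
    then have "eventually (\<lambda>t. c t \<in> E) (at s within T)"
      using E cs by (intro topological_tendstoD) auto
    moreover have "eventually (\<lambda>t. t \<in> T) (at s within T)"
      by (simp add: eventually_at_filter)
    ultimately have "eventually (\<lambda>t. norm ((1 / norm (t - s)) *\<^sub>R (Z t - c t))
        \<le> norm ((1 / norm (t - s)) *\<^sub>R h t) * 2) (at s within T)"
    proof eventually_elim
      case (elim t)
      then have "norm (Z t - c t) \<le> 2 * norm (h t)" unfolding h_def using expansive by blast
      then have "norm (Z t - c t) / \<bar>t - s\<bar> \<le> (2 * norm (h t)) / \<bar>t - s\<bar>"
        by (rule divide_right_mono) simp
      then show ?case by (simp add: mult.commute)
    qed
    with lim have "((\<lambda>t. (1 / norm (t - s)) *\<^sub>R (Z t - c t)) \<longlongrightarrow> 0) (at s within T)"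
      by (rule tendsto_0_le)
    then have "((\<lambda>t. Z t - c t) has_vector_derivative 0) (at s within T)"
      by (simp add: has_vector_derivative_def has_derivative_within cs)
    from has_vector_derivative_add[OF this c] show "(Z has_vector_derivative w) (at s within T)"
      by simp
  qed
qed

section \<open>Averaging of the slow system\<close>

text \<open>F is the exact slow field and G its globally smooth model. They are compared only along
  \<sigma> = S t and on the strip from \<epsilon>/2 to r - \<epsilon>/2. This suffices because the
  transformation is built from G, while \<open>W\<close> is defined so that the transformed equation
  for F is exact.\<close>

lemma averaging:
  fixes F :: "real \<Rightarrow> real \<times> real \<Rightarrow> real \<times> real" and S a :: "real \<Rightarrow> real"
    and G :: "((real \<times> real) \<times> real) \<times> real \<Rightarrow> real \<times> real" and \<epsilon> r P C :: real
    and q N :: nat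
  defines "\<mu> \<equiv> \<lambda>t. t powr - (1 / real q)" and "D \<equiv> {0<..r} \<times> UNIV"
  assumes q: "q > 0" and \<epsilon>: "0 < \<epsilon>" "\<epsilon> < r / 2" and P: "P > 0"
    and S: "smooth_on {0<..} S"
    and G: "smooth_on UNIV G" "biperiodic (0, 2 * pi) P G" "\<And>y. G (y, 0) = 0"
    and a: "smooth_on UNIV a" "a 0 \<noteq> 0"
    and F_periodic: "\<And>t Z. t > 0 \<Longrightarrow> Z \<in> D \<Longrightarrow> F t (Z + (0, 2 * pi)) = F t Z"
    and FG: "\<forall>\<^sub>F t in at_top. \<forall>Z\<in>{\<epsilon> / 2..r - \<epsilon> / 2} \<times> UNIV.
      norm (F t Z - G ((Z, S t), \<mu> t)) \<le> C * \<mu> t ^ (N + 1)"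
    and Sa: "\<forall>\<^sub>F t in at_top. \<bar>deriv S t - a (\<mu> t)\<bar> \<le> C * \<mu> t ^ (N + 1)"
  obtains t\<^sub>0 U l W C' where "t\<^sub>0 > 0" "smooth_on (UNIV \<times> {0<..}) U"
    "\<And>Z t. U (Z + (0, 2 * pi), t) = U (Z, t)"
    "\<And>t Z. t \<ge> t\<^sub>0 \<Longrightarrow> Z \<in> D \<Longrightarrow> norm (U (Z, t)) \<le> \<epsilon>"
    "\<And>t. t \<ge> t\<^sub>0 \<Longrightarrow> inj_on (\<lambda>Z. Z + U (Z, t)) D"
    "\<And>t. t \<ge> t\<^sub>0 \<Longrightarrow> {\<epsilon>..r - \<epsilon>} \<times> UNIV \<subseteq> (\<lambda>Z. Z + U (Z, t)) ` D"
    "\<And>T Z s. T \<subseteq> {t\<^sub>0..} \<Longrightarrow> Z ` T \<subseteq> D \<Longrightarrow> s \<in> T \<Longrightarrow>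
      (Z has_vector_derivative F s (Z s)) (at s within T) \<longleftrightarrow>
      ((\<lambda>t. Z t + U (Z t, t)) has_vector_derivative
        (\<Sum>k=1..N. \<mu> s ^ k *\<^sub>R l k (Z s + U (Z s, s))) + W (Z s + U (Z s, s)) s) (at s within T)"
    "\<And>k Z. l k (Z + (0, 2 * pi)) = l k Z"
    "\<And>t z. t \<ge> t\<^sub>0 \<Longrightarrow> W (z + (0, 2 * pi)) t = W z t"
    "\<forall>\<^sub>F t in at_top. \<forall>z\<in>{\<epsilon>..r - \<epsilon>} \<times> UNIV. norm (W z t) \<le> C' * \<mu> t ^ (N + 1)"
proof -
  \<comment> \<open>This polynomial is what remains of -(1/q) \<mu>^(q+1) after \<mu>^2 is split
    off, which is possible since q is at least 1.\<close>
  define c where "c m = - (1 / real q) * m ^ (q - 1)" for m :: real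
  define b where "b m = m * m * c m" for m
  have c: "smooth_on UNIV c" unfolding c_def by (intro smooth_intros)
  have "P \<noteq> 0" using P by simp
  from normal_form[OF G a(1) refl a(2) b_def c this, of N] obtain V l H where V: "smooth_on UNIV V" "biperiodic (0, 2 * pi) P V"
    and H: "smooth_on UNIV H" "biperiodic (0, 2 * pi) P H"
    and l: "\<And>k Z. l k (Z + (0, 2 * pi)) = l k Z"
    and defect: "\<And>x. conj_defect G a b (\<lambda>x. snd x *\<^sub>R V x) l N x = snd x ^ (N + 1) *\<^sub>R H x"
    by blast
  define U where "U x = snd x *\<^sub>R V x" for x
  define u where "u w = U ((fst w, S (snd w)), \<mu> (snd w))" for w
  \<comment> \<open>A margin of 1 around the radii of \<open>D\<close>: tangent lines at the
    boundary radius r need an open neighbourhood, and the bounds need a compact range of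
    radii.\<close>
  define E where "E = {-1..r + 1} \<times> (UNIV :: real set)"
  have U: "smooth_on UNIV U" "biperiodic (0, 2 * pi) P U"
    using V by (auto simp: U_def[abs_def] biperiodic_def intro!: smooth_intros)
  obtain BV where BV: "BV \<ge> 0" "\<And>Z \<sigma> m. Z \<in> E \<Longrightarrow> m \<in> {0..1} \<Longrightarrow> norm (V ((Z, \<sigma>), m)) \<le> BV"
    using biperiodic_bounded[OF smooth_on_imp_continuous_on[OF V(1)] V(2) _ P, of "-1" "r + 1"]
    by (auto simp: E_def)
  obtain BL where BL: "BL \<ge> 0" "\<And>Z Z' \<sigma> m. Z \<in> E \<Longrightarrow> Z' \<in> E \<Longrightarrow> m \<in> {0..1} \<Longrightarrow>
      norm (V ((Z, \<sigma>), m) - V ((Z', \<sigma>), m)) \<le> BL * norm (Z - Z')"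
    using biperiodic_lipschitz[OF V _ P, of "-1" "r + 1"] unfolding E_def by auto
  obtain BH where BH: "BH \<ge> 0" "\<And>Z \<sigma> m. Z \<in> E \<Longrightarrow> m \<in> {0..1} \<Longrightarrow> norm (H ((Z, \<sigma>), m)) \<le> BH"
    using biperiodic_bounded[OF smooth_on_imp_continuous_on[OF H(1)] H(2) _ P, of "-1" "r + 1"]
    by (auto simp: E_def)
  obtain BD where BD: "BD \<ge> 0" "\<And>Z \<sigma> m v. Z \<in> E \<Longrightarrow> m \<in> {0..1} \<Longrightarrow>
      norm (frechet_derivative U (at ((Z, \<sigma>), m)) v) \<le> BD * norm v"
    using biperiodic_derivative_bounded[OF U _ P, of "-1" "r + 1"] by (auto simp: E_def)
  have DE: "D \<subseteq> E" by (auto simp: D_def E_def)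

  \<comment> \<open>Below \<delta> the bounds for \<mu> in [0, 1] apply, \<open>u\<close> is at most
    \<epsilon>/2 and its Lipschitz constant is at most 1/2. Adding 1 to \<open>BV\<close> and
    \<open>BL\<close> keeps the denominators positive. Half of the permitted \<epsilon> is used so
    that preimages of the inner strip stay where F and G are close.\<close>
  define \<delta> where "\<delta> = min 1 (min (\<epsilon> / 2 / (BV + 1)) (1 / 2 / (BL + 1)))"
  have "\<delta> > 0" using \<epsilon> BV(1) BL(1) by (simp add: \<delta>_def)
  have "(\<mu> \<longlongrightarrow> 0) at_top"
    unfolding \<mu>_def using q by (intro tendsto_neg_powr filterlim_ident) simp
  then have "\<forall>\<^sub>F t in at_top. \<mu> t < \<delta>" using \<open>\<delta> > 0\<close> by (rule order_tendstoD)
  then obtain t1 where t1: "\<And>t. t \<ge> t1 \<Longrightarrow> \<mu> t < \<delta>" by (auto simp: eventually_at_top_linorder)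
  define t\<^sub>0 where "t\<^sub>0 = max t1 1"
  have t0: "t\<^sub>0 > 0" by (simp add: t\<^sub>0_def)
  have \<mu>_pos: "\<mu> t > 0" if "t > 0" for t using that by (simp add: \<mu>_def)
  have \<mu>: "0 < \<mu> t" "\<mu> t \<in> {0..1}" "\<mu> t * (BV + 1) \<le> \<epsilon> / 2" "\<mu> t * (BL + 1) \<le> 1 / 2"
    if "t \<ge> t\<^sub>0" for t
  proof -
    show "0 < \<mu> t" using that t0 by (intro \<mu>_pos) auto
    have "\<mu> t \<le> \<delta>" using t1[of t] that by (simp add: t\<^sub>0_def)
    then have le: "\<mu> t \<le> 1" "\<mu> t \<le> \<epsilon> / 2 / (BV + 1)" "\<mu> t \<le> 1 / 2 / (BL + 1)"
      by (auto simp: \<delta>_def)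
    with \<open>0 < \<mu> t\<close> show "\<mu> t \<in> {0..1}" by simp
    show "\<mu> t * (BV + 1) \<le> \<epsilon> / 2" using le(2) BV(1) by (subst (asm) pos_le_divide_eq) auto
    show "\<mu> t * (BL + 1) \<le> 1 / 2" using le(3) BL(1) by (subst (asm) pos_le_divide_eq) auto
  qed
  have u_small: "norm (u (Z, t)) \<le> \<epsilon> / 2" if "t \<ge> t\<^sub>0" "Z \<in> E" for Z t
  proof -
    have "norm (u (Z, t)) \<le> \<mu> t * BV"
      using \<mu>[OF that(1)] BV(2)[OF that(2)] by (auto simp: u_def U_def intro!: mult_mono)
    also have "\<dots> \<le> \<mu> t * (BV + 1)" using \<mu>[OF that(1)] by (intro mult_left_mono) auto
    finally show ?thesis using \<mu>[OF that(1)] by linarith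
  qed
  have u_lip: "norm (u (Z, t) - u (Z', t)) \<le> norm (Z - Z') / 2" if "t \<ge> t\<^sub>0" "Z \<in> E" "Z' \<in> E" for Z Z' t
  proof -
    have "norm (u (Z, t) - u (Z', t)) = \<mu> t * norm (V ((Z, S t), \<mu> t) - V ((Z', S t), \<mu> t))"
      using \<mu>[OF that(1)] by (simp add: u_def U_def flip: scaleR_diff_right)
    also have "\<dots> \<le> \<mu> t * (BL * norm (Z - Z'))"
      using \<mu>[OF that(1)] BL(2)[OF that(2,3)] by (intro mult_left_mono) auto
    also have "\<dots> \<le> (\<mu> t * (BL + 1)) * norm (Z - Z')"
      using \<mu>[OF that(1)] by (simp add: algebra_simps)
    also have "\<dots> \<le> 1 / 2 * norm (Z - Z')" using \<mu>[OF that(1)] by (intro mult_right_mono) auto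
    finally show ?thesis by simp
  qed
  note expansive = perturbed_identity_expansive[OF u_lip]
  have inj: "inj_on (\<lambda>Z. Z + u (Z, t)) D" if "t \<ge> t\<^sub>0" for t
  proof (rule inj_onI)
    fix Z Z' assume "Z \<in> D" "Z' \<in> D" and eq: "Z + u (Z, t) = Z' + u (Z', t)"
    then have "norm (Z - Z') \<le> 2 * norm ((Z + u (Z, t)) - (Z' + u (Z', t)))"
      using DE by (intro expansive that) auto
    then show "Z = Z'" by (simp add: eq)
  qed
  have surj: "{\<epsilon>..r - \<epsilon>} \<times> UNIV \<subseteq> (\<lambda>Z. Z + u (Z, t)) ` D" if t: "t \<ge> t\<^sub>0" for t
  proof
    fix z :: "real \<times> real" assume z: "z \<in> {\<epsilon>..r - \<epsilon>} \<times> UNIV"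
    then have sub: "{fst z - \<epsilon> / 2..fst z + \<epsilon> / 2} \<times> UNIV \<subseteq> D"
      using \<epsilon> by (auto simp: D_def mem_Times_iff)
    obtain Z where "Z \<in> {fst z - \<epsilon> / 2..fst z + \<epsilon> / 2} \<times> UNIV" "Z + u (Z, t) = z"
      by (rule perturbed_identity_surjective[OF order.trans[OF sub DE] u_lip[OF t] u_small[OF t]])
        (use sub DE \<epsilon> in auto)
    then show "z \<in> (\<lambda>Z. Z + u (Z, t)) ` D" using sub by blast
  qed

  \<comment> \<open>The velocity of \<open>Z + u (Z, t)\<close> along the exact field, with the true
    \<open>deriv S t\<close> and not its model \<open>a (\<mu> t)\<close>.\<close>
  define R where "R t Z = F t Z + frechet_derivative U (at ((Z, S t), \<mu> t)) ((F t Z, deriv S t), b (\<mu> t))"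
    for t Z
  have dS: "(S has_real_derivative deriv S t) (at t)" if "t > 0" for t
    using smooth_on_imp_has_real_derivative[OF S open_greaterThan] that by simp
  have d\<mu>: "(\<mu> has_real_derivative b (\<mu> t)) (at t)" if "t > 0" for t
  proof -
    have "\<mu> t * \<mu> t * \<mu> t ^ (q - 1) = \<mu> t ^ (q + 1)"
      using q by (simp flip: power_Suc power_Suc2 add: mult.assoc)
    also have "\<dots> = t powr (real (q + 1) * - (1 / real q))"
      unfolding \<mu>_def by (rule powr_power) (use that in simp)
    also have "real (q + 1) * - (1 / real q) = - (1 / real q) - 1"
      using q by (simp add: field_simps)
    finally show ?thesis
      using that unfolding \<mu>_def b_def c_def by (auto intro!: derivative_eq_intros)
  qed
  have transform: "(Z has_vector_derivative F s (Z s)) (at s within T) \<longleftrightarrow>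
      ((\<lambda>t. Z t + u (Z t, t)) has_vector_derivative R s (Z s)) (at s within T)"
    if T: "T \<subseteq> {t\<^sub>0..}" and Z: "Z ` T \<subseteq> D" and s: "s \<in> T" for T Z s
  proof -
    let ?x = "((Z s, S s), \<mu> s)"
    have s0: "s > 0" using T s t0 by force
    have "(S has_derivative (\<lambda>h. h * deriv S s)) (at (snd (Z s, s)))"
      "(\<mu> has_derivative (\<lambda>h. h * b (\<mu> s))) (at (snd (Z s, s)))"
      unfolding snd_conv
      by (rule has_derivative_eq_rhs[OF has_field_derivative_imp_has_derivative[OF dS[OF s0]]]
          has_derivative_eq_rhs[OF has_field_derivative_imp_has_derivative[OF d\<mu>[OF s0]]],
          simp add: fun_eq_iff)+
    from this[THEN has_derivative_compose[OF has_derivative_snd[OF has_derivative_ident]]]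
    have "((\<lambda>w. ((fst w, S (snd w)), \<mu> (snd w))) has_derivative
        (\<lambda>v. ((fst v, snd v * deriv S s), snd v * b (\<mu> s)))) (at (Z s, s))"
      by (auto intro!: derivative_eq_intros)
    from has_derivative_compose[OF this smooth_imp_has_derivative[OF U(1)]]
    have du: "(u has_derivative (\<lambda>v. frechet_derivative U (at ?x)
        ((fst v, snd v * deriv S s), snd v * b (\<mu> s)))) (at (Z s, s))"
      by (simp add: u_def[abs_def])
    have "norm (Z t - X) \<le> 2 * norm ((Z t + u (Z t, t)) - (X + u (X, t)))"
      if "t \<in> T" "X \<in> {-1<..<r + 1} \<times> UNIV" for t X
      using that T Z DE by (intro expansive) (auto simp: E_def)
    moreover have "Z s \<in> {-1<..<r + 1} \<times> UNIV" using Z s by (auto simp: D_def)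
    ultimately have "(Z has_vector_derivative F s (Z s)) (at s within T) \<longleftrightarrow>
      ((\<lambda>t. Z t + u (Z t, t)) has_vector_derivative F s (Z s) + (\<lambda>v. frechet_derivative U (at ?x)
        ((fst v, snd v * deriv S s), snd v * b (\<mu> s))) (F s (Z s), 1)) (at s within T)"
      by (intro has_vector_derivative_transform_iff[where Z = Z and s = s and u = u, OF du s,
            where E = "{-1<..<r + 1} \<times> UNIV"] open_Times) auto
    then show ?thesis by (simp add: R_def)
  qed

  define L where "L z t = (\<Sum>k=1..N. \<mu> t ^ k *\<^sub>R l k z)" for z t
  define X where "X z t = inv_into D (\<lambda>Z. Z + u (Z, t)) z" for z t
  \<comment> \<open>The exact remainder, read off at the preimage; it depends on \<open>\<sigma>\<close> only through \<open>S t\<close>.\<close>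
  define W where "W z t = (if z \<in> (\<lambda>Z. Z + u (Z, t)) ` D then R t (X z t) - L z t else 0)" for z t
  have W: "W (Z + u (Z, t)) t = R t Z - L (Z + u (Z, t)) t" if "t \<ge> t\<^sub>0" "Z \<in> D" for Z t
    using inv_into_f_f[OF inj[OF that(1)] that(2)] that(2) by (simp add: W_def X_def)
  have u_per: "u (Z + (0, 2 * pi), t) = u (Z, t)" for Z t
    using biperiodicD(1)[OF U(2)] by (simp add: u_def)
  have D_shift: "Z + (0, v) \<in> D" if "Z \<in> D" for Z v using that by (auto simp: D_def)
  have R_per: "R t (Z + (0, 2 * pi)) = R t Z" if "t > 0" "Z \<in> D" for Z t
    using F_periodic[OF that] biperiodicD(1)[OF biperiodic_frechet_derivative[OF U]]
    by (simp add: R_def)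
  have L_per: "L (z + (0, 2 * pi)) t = L z t" for z t by (simp add: L_def l)
  have W_per: "W (z + (0, 2 * pi)) t = W z t" if t: "t \<ge> t\<^sub>0" for z t
  proof (cases "z \<in> (\<lambda>Z. Z + u (Z, t)) ` D")
    case True
    then obtain Z where Z: "Z \<in> D" "z = Z + u (Z, t)" by blast
    have eq: "z + (0, 2 * pi) = (Z + (0, 2 * pi)) + u (Z + (0, 2 * pi), t)"
      unfolding u_per Z(2) by (simp add: ac_simps)
    have "W (z + (0, 2 * pi)) t = R t (Z + (0, 2 * pi)) - L (z + (0, 2 * pi)) t"
      unfolding eq by (rule W[OF t D_shift[OF Z(1)]])
    also have "\<dots> = R t Z - L z t" using R_per Z(1) t t0 L_per by simp
    finally show ?thesis using W[OF t Z(1)] Z(2) by simp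
  next
    case False
    \<comment> \<open>The image of \<open>D\<close> is invariant under the shift in both directions,
      so the default value 0 of \<open>W\<close> is periodic as well.\<close>
    have "z + (0, 2 * pi) \<notin> (\<lambda>Z. Z + u (Z, t)) ` D"
    proof
      assume "z + (0, 2 * pi) \<in> (\<lambda>Z. Z + u (Z, t)) ` D"
      then obtain Z where Z: "Z \<in> D" "z + (0, 2 * pi) = Z + u (Z, t)" by blast
      have shift: "Z + (0, - (2 * pi)) + (0, 2 * pi) = Z" by (simp add: add.assoc zero_prod_def)
      have "z = (Z + (0, - (2 * pi))) + u (Z + (0, - (2 * pi)), t)"
        using u_per[of "Z + (0, - (2 * pi))" t] Z(2) unfolding shift
        by (cases z; cases Z; cases "u (Z, t)") auto
      with D_shift[OF Z(1)] False show False by blast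
    qed
    with False show ?thesis by (simp add: W_def)
  qed

  have bound: "norm (R t Z - L (Z + u (Z, t)) t) \<le> (BH + C + BD * (C + C)) * \<mu> t ^ (N + 1)"
    if t: "t \<ge> t\<^sub>0" and Z: "Z \<in> E"
      and F: "norm (F t Z - G ((Z, S t), \<mu> t)) \<le> C * \<mu> t ^ (N + 1)"
      and S: "\<bar>deriv S t - a (\<mu> t)\<bar> \<le> C * \<mu> t ^ (N + 1)" for t Z
  proof -
    let ?x = "((Z, S t), \<mu> t)" and ?m = "\<mu> t ^ (N + 1)"
    let ?D = "frechet_derivative U (at ?x)"
    let ?v = "((F t Z - G ?x, deriv S t - a (\<mu> t)), 0 :: real)"
    interpret bounded_linear ?D
      using smooth_imp_has_derivative[OF U(1)] by (rule has_derivative_bounded_linear)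
    \<comment> \<open>Only F and S' are replaced by models, \<open>b\<close> being exact. By
      linearity the replacement costs the derivative at the error vector \<open>?v\<close>; the part
      with the models is the defect supplied by the normal form.\<close>
    have "?D ((F t Z, deriv S t), b (\<mu> t)) = ?D ((G ?x, a (\<mu> t)), b (\<mu> t)) + ?D ?v"
      by (simp flip: add)
    moreover have "G ?x + ?D ((G ?x, a (\<mu> t)), b (\<mu> t)) - L (Z + u (Z, t)) t = ?m *\<^sub>R H ?x"
      using defect[of ?x] by (simp add: conj_defect_def L_def u_def U_def[abs_def])
    ultimately have eq: "R t Z - L (Z + u (Z, t)) t = ?m *\<^sub>R H ?x + (F t Z - G ?x) + ?D ?v"
      unfolding R_def by (simp add: algebra_simps)
    have m: "0 \<le> ?m" using \<mu>(1)[OF t] by simp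
    have H_le: "norm (?m *\<^sub>R H ?x) \<le> ?m * BH"
      unfolding norm_scaleR abs_of_nonneg[OF m]
      by (rule mult_left_mono[OF BH(2)[OF Z \<mu>(2)[OF t]] m])
    have "norm ?v \<le> norm (F t Z - G ?x) + \<bar>deriv S t - a (\<mu> t)\<bar>"
      using norm_Pair_le[of "F t Z - G ?x" "deriv S t - a (\<mu> t)"] by simp
    also have "\<dots> \<le> C * ?m + C * ?m" using F S by (rule add_mono)
    finally have "BD * norm ?v \<le> BD * (C * ?m + C * ?m)" using BD(1) by (rule mult_left_mono)
    with BD(2)[OF Z \<mu>(2)[OF t]] have D_le: "norm (?D ?v) \<le> BD * (C * ?m + C * ?m)"
      by (rule order_trans)
    have "norm (R t Z - L (Z + u (Z, t)) t) \<le> ?m * BH + C * ?m + BD * (C * ?m + C * ?m)"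
      unfolding eq
      by (rule order_trans[OF norm_triangle_ineq add_mono[OF order_trans[OF norm_triangle_ineq
            add_mono[OF H_le F]] D_le]])
    also have "\<dots> = (BH + C + BD * (C + C)) * ?m" by (simp only: algebra_simps)
    finally show ?thesis .
  qed
  have W_bound: "\<forall>\<^sub>F t in at_top. \<forall>z\<in>{\<epsilon>..r - \<epsilon>} \<times> UNIV.
      norm (W z t) \<le> (BH + C + BD * (C + C)) * \<mu> t ^ (N + 1)"
    using FG Sa eventually_ge_at_top[of t\<^sub>0]
  proof eventually_elim
    case (elim t)
    show ?case
    proof
      fix z :: "real \<times> real" assume z: "z \<in> {\<epsilon>..r - \<epsilon>} \<times> UNIV"
      then obtain Z where Z: "Z \<in> D" "z = Z + u (Z, t)" using surj[OF elim(3)] by blast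
      \<comment> \<open>The bound \<epsilon>/2 puts the preimage Z in the strip on which F and G
        were compared.\<close>
      have "\<bar>fst (u (Z, t))\<bar> \<le> \<epsilon> / 2"
        using u_small[OF elim(3), of Z] Z(1) DE norm_fst_le[of "fst (u (Z, t))" "snd (u (Z, t))"] by auto
      then have "Z \<in> {\<epsilon> / 2..r - \<epsilon> / 2} \<times> UNIV"
        using z Z(2) by (auto simp: mem_Times_iff)
      then show "norm (W z t) \<le> (BH + C + BD * (C + C)) * \<mu> t ^ (N + 1)"
        using elim bound[OF elim(3)] W[OF elim(3) Z(1)] Z DE by auto
    qed
  qed
  have u_smooth: "smooth_on (UNIV \<times> {0<..}) u"
    unfolding u_def \<mu>_def
    by (rule smooth_on_compose_UNIV[OF U(1)])
      (auto intro!: smooth_intros smooth_on_compose[OF S] smooth_on_compose[OF smooth_on_powr])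
  have u_eps: "norm (u (Z, t)) \<le> \<epsilon>" if "t \<ge> t\<^sub>0" "Z \<in> D" for Z t
    using u_small[of t Z] that DE \<epsilon> by force
  have ode: "(Z has_vector_derivative F s (Z s)) (at s within T) \<longleftrightarrow>
      ((\<lambda>t. Z t + u (Z t, t)) has_vector_derivative
        (\<Sum>k=1..N. \<mu> s ^ k *\<^sub>R l k (Z s + u (Z s, s))) + W (Z s + u (Z s, s)) s) (at s within T)"
    if "T \<subseteq> {t\<^sub>0..}" "Z ` T \<subseteq> D" "s \<in> T" for T Z s
  proof -
    have "s \<ge> t\<^sub>0" "Z s \<in> D" using that by auto
    from W[OF this] transform[OF that] show ?thesis by (simp add: L_def)
  qed
  show thesis
    by (rule that[OF t0 u_smooth u_per u_eps inj surj ode l W_per W_bound])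
qed

section \<open>Return to the original system\<close>

lemma has_vector_derivative_Pair_iff:
  "((\<lambda>t. (x t, y t)) has_vector_derivative (a, b)) (at s within T) \<longleftrightarrow>
     (x has_vector_derivative a) (at s within T) \<and> (y has_vector_derivative b) (at s within T)"
proof
  assume "((\<lambda>t. (x t, y t)) has_vector_derivative (a, b)) (at s within T)"
  from bounded_linear.has_vector_derivative[OF bounded_linear_fst this]
    bounded_linear.has_vector_derivative[OF bounded_linear_snd this]
  show "(x has_vector_derivative a) (at s within T) \<and> (y has_vector_derivative b) (at s within T)"
    by simp
qed (simp add: has_vector_derivative_Pair)

lemma solves_on_iff_has_vector_derivative:
  "solves_on T F G x y \<longleftrightarrow> (\<forall>t\<in>T.
     ((\<lambda>t. (x t, y t)) has_vector_derivative (F (x t) (y t) t, G (x t) (y t) t)) (at t within T))"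
  by (simp add: solves_on_def has_vector_derivative_Pair_iff has_real_derivative_iff_has_vector_derivative)

theorem theorem1:
  fixes \<omega> \<R> s\<^sub>0 :: real
    and q :: nat
    and \<kappa> \<nu> :: int
    and f g :: "real \<Rightarrow> real \<Rightarrow> real \<Rightarrow> real \<Rightarrow> real"
    and fk gk :: "nat \<Rightarrow> real \<Rightarrow> real \<Rightarrow> real \<Rightarrow> real"
    and S :: "real \<Rightarrow> real"
    and s :: "nat \<Rightarrow> real"
  assumes "\<omega> > 0" and "\<R> > 0" and "q > 0"
    and f_smooth: "smooth_on ({0<..\<R>} \<times> UNIV \<times> UNIV \<times> {0<..}) (\<lambda>(\<rho>, \<phi>, \<sigma>, t). f \<rho> \<phi> \<sigma> t)"
    and g_smooth: "smooth_on ({0<..\<R>} \<times> UNIV \<times> UNIV \<times> {0<..}) (\<lambda>(\<rho>, \<phi>, \<sigma>, t). g \<rho> \<phi> \<sigma> t)"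
    and f_periodic: "\<forall>\<rho>\<in>{0<..\<R>}. \<forall>\<phi> \<sigma>. \<forall>t>0.
          f \<rho> (\<phi> + 2 * pi) \<sigma> t = f \<rho> \<phi> \<sigma> t \<and> f \<rho> \<phi> (\<sigma> + 2 * pi) t = f \<rho> \<phi> \<sigma> t"
    and g_periodic: "\<forall>\<rho>\<in>{0<..\<R>}. \<forall>\<phi> \<sigma>. \<forall>t>0.
          g \<rho> (\<phi> + 2 * pi) \<sigma> t = g \<rho> \<phi> \<sigma> t \<and> g \<rho> \<phi> (\<sigma> + 2 * pi) t = g \<rho> \<phi> \<sigma> t"
    and S_smooth: "smooth_on {0<..} S"
    and S_deriv: "deriv S \<sim>[at_top] (\<lambda>_. s\<^sub>0)"
    and s0_pos: "s\<^sub>0 > 0"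
    and resonance: "coprime \<kappa> \<nu>" "of_int \<kappa> * s\<^sub>0 = of_int \<nu> * \<omega>"
    and f_vanishes: "\<forall>\<rho>\<in>{0<..\<R>}. \<forall>\<phi>. ((\<lambda>t. f \<rho> \<phi> (S t) t) \<longlongrightarrow> 0) at_top"
    and g_vanishes: "\<forall>\<rho>\<in>{0<..\<R>}. \<forall>\<phi>. ((\<lambda>t. g \<rho> \<phi> (S t) t) \<longlongrightarrow> 0) at_top"
    and f_expansion: "\<forall>\<delta>>0. asymp_series_on ({\<delta>..\<R>} \<times> UNIV \<times> UNIV) q
          (\<lambda>t (\<rho>, \<phi>, \<sigma>). f \<rho> \<phi> \<sigma> t) (\<lambda>k (\<rho>, \<phi>, \<sigma>). fk k \<rho> \<phi> \<sigma>)"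
    and g_expansion: "\<forall>\<delta>>0. asymp_series_on ({\<delta>..\<R>} \<times> UNIV \<times> UNIV) q
          (\<lambda>t (\<rho>, \<phi>, \<sigma>). g \<rho> \<phi> \<sigma> t) (\<lambda>k (\<rho>, \<phi>, \<sigma>). gk k \<rho> \<phi> \<sigma>)"
    and S_expansion: "asymp_series q (\<lambda>t. deriv S t - s\<^sub>0) s"
    and fk_smooth: "\<forall>k\<ge>1. smooth_on ({0<..\<R>} \<times> UNIV \<times> UNIV) (\<lambda>(\<rho>, \<phi>, \<sigma>). fk k \<rho> \<phi> \<sigma>)"
    and gk_smooth: "\<forall>k\<ge>1. smooth_on ({0<..\<R>} \<times> UNIV \<times> UNIV) (\<lambda>(\<rho>, \<phi>, \<sigma>). gk k \<rho> \<phi> \<sigma>)"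
    and fk_periodic: "\<forall>k\<ge>1. \<forall>\<rho>\<in>{0<..\<R>}. \<forall>\<phi> \<sigma>.
          fk k \<rho> (\<phi> + 2 * pi) \<sigma> = fk k \<rho> \<phi> \<sigma> \<and> fk k \<rho> \<phi> (\<sigma> + 2 * pi) = fk k \<rho> \<phi> \<sigma>"
    and gk_periodic: "\<forall>k\<ge>1. \<forall>\<rho>\<in>{0<..\<R>}. \<forall>\<phi> \<sigma>.
          gk k \<rho> (\<phi> + 2 * pi) \<sigma> = gk k \<rho> \<phi> \<sigma> \<and> gk k \<rho> \<phi> (\<sigma> + 2 * pi) = gk k \<rho> \<phi> \<sigma>"
  shows "\<forall>N::nat. \<forall>\<epsilon>::real. N > 0 \<longrightarrow> \<epsilon> \<in> {0<..<\<R> / 2} \<longrightarrow>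
    (\<exists>(t\<^sub>0::real)
      (U :: real \<Rightarrow> real \<Rightarrow> real \<Rightarrow> real) (V :: real \<Rightarrow> real \<Rightarrow> real \<Rightarrow> real)
      (\<Lambda> :: nat \<Rightarrow> real \<Rightarrow> real \<Rightarrow> real) (\<Omega> :: nat \<Rightarrow> real \<Rightarrow> real \<Rightarrow> real)
      (\<Lambda>r :: real \<Rightarrow> real \<Rightarrow> real \<Rightarrow> real \<Rightarrow> real) (\<Omega>r :: real \<Rightarrow> real \<Rightarrow> real \<Rightarrow> real \<Rightarrow> real).
      t\<^sub>0 > 0 \<and>
      smooth_on ({0<..\<R>} \<times> UNIV \<times> {0<..}) (\<lambda>(R, \<Psi>, t). U R \<Psi> t) \<and>
      smooth_on ({0<..\<R>} \<times> UNIV \<times> {0<..}) (\<lambda>(R, \<Psi>, t). V R \<Psi> t) \<and>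
      (\<forall>R\<in>{0<..\<R>}. \<forall>\<Psi>. \<forall>t>0.
         U R (\<Psi> + 2 * pi) t = U R \<Psi> t \<and> V R (\<Psi> + 2 * pi) t = V R \<Psi> t) \<and>
      (\<forall>R\<in>{0<..\<R>}. \<forall>\<Psi>. \<forall>t\<ge>t\<^sub>0. \<bar>U R \<Psi> t\<bar> \<le> \<epsilon> \<and> \<bar>V R \<Psi> t\<bar> \<le> \<epsilon>) \<and>
      (\<forall>t\<ge>t\<^sub>0.
         bij_betw (\<lambda>(\<rho>, \<phi>). (\<rho>, \<phi> - of_int \<kappa> / of_int \<nu> * S t)) ({0<..\<R>} \<times> UNIV) ({0<..\<R>} \<times> UNIV) \<and>
         inj_on (\<lambda>(R, \<Psi>). (R + U R \<Psi> t, \<Psi> + V R \<Psi> t)) ({0<..\<R>} \<times> UNIV) \<and>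
         {\<epsilon>..\<R> - \<epsilon>} \<times> UNIV \<subseteq> (\<lambda>(R, \<Psi>). (R + U R \<Psi> t, \<Psi> + V R \<Psi> t)) ` ({0<..\<R>} \<times> UNIV)) \<and>
      (\<forall>T (\<rho> :: real \<Rightarrow> real) (\<phi> :: real \<Rightarrow> real) R \<Psi> r \<psi>.
         is_interval T \<longrightarrow> T \<subseteq> {t\<^sub>0..} \<longrightarrow> \<rho> ` T \<subseteq> {0<..\<R>} \<longrightarrow>
         R = \<rho> \<longrightarrow> \<Psi> = (\<lambda>t. \<phi> t - of_int \<kappa> / of_int \<nu> * S t) \<longrightarrow>
         r = (\<lambda>t. R t + U (R t) (\<Psi> t) t) \<longrightarrow> \<psi> = (\<lambda>t. \<Psi> t + V (R t) (\<Psi> t) t) \<longrightarrow>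
         r ` T \<subseteq> {0<..\<R>} \<longrightarrow>
         (solves_on T (\<lambda>\<rho> \<phi> t. f \<rho> \<phi> (S t) t) (\<lambda>\<rho> \<phi> t. \<omega> + g \<rho> \<phi> (S t) t) \<rho> \<phi> \<longleftrightarrow>
          solves_on T
            (\<lambda>r \<psi> t. (\<Sum>k=1..N. t powr (- (real k / real q)) * \<Lambda> k r \<psi>) + \<Lambda>r r \<psi> (S t) t)
            (\<lambda>r \<psi> t. (\<Sum>k=1..N. t powr (- (real k / real q)) * \<Omega> k r \<psi>) + \<Omega>r r \<psi> (S t) t)
            r \<psi>)) \<and>
      (\<forall>k\<in>{1..N}. \<forall>r\<in>{0<..\<R>}. \<forall>\<psi>.
         \<Lambda> k r (\<psi> + 2 * pi) = \<Lambda> k r \<psi> \<and> \<Omega> k r (\<psi> + 2 * pi) = \<Omega> k r \<psi>) \<and>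
      (\<forall>r\<in>{0<..\<R>}. \<forall>\<psi> \<sigma>. \<forall>t\<ge>t\<^sub>0.
         \<Lambda>r r (\<psi> + 2 * pi) \<sigma> t = \<Lambda>r r \<psi> \<sigma> t \<and>
         \<Omega>r r (\<psi> + 2 * pi) \<sigma> t = \<Omega>r r \<psi> \<sigma> t \<and>
         \<Lambda>r r \<psi> (\<sigma> + 2 * pi * of_int \<nu>) t = \<Lambda>r r \<psi> \<sigma> t \<and>
         \<Omega>r r \<psi> (\<sigma> + 2 * pi * of_int \<nu>) t = \<Omega>r r \<psi> \<sigma> t) \<and>
      (\<exists>C. \<forall>\<^sub>F t in at_top. \<forall>r\<in>{\<epsilon>..\<R> - \<epsilon>}. \<forall>\<psi> \<sigma>.
         \<bar>\<Lambda>r r \<psi> \<sigma> t\<bar> \<le> C * t powr (- (real (N + 1) / real q)) \<and>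
         \<bar>\<Omega>r r \<psi> \<sigma> t\<bar> \<le> C * t powr (- (real (N + 1) / real q))))"
proof (intro allI impI, goal_cases)
  case (1 N \<epsilon>)
  then have \<epsilon>: "0 < \<epsilon>" "\<epsilon> < \<R> / 2" by auto
  \<comment> \<open>For \<nu> = 0 the resonance condition forces \<kappa> = 0, against
    coprimality.\<close>
  have "\<nu> \<noteq> 0"
    using resonance s0_pos by auto
  define c :: real where "c = of_int \<kappa> / of_int \<nu>"
  \<comment> \<open>This removes the constant from \<Psi>' = \<omega> + g - c S'.\<close>
  have c: "c * s\<^sub>0 = \<omega>"
    using resonance(2) \<open>\<nu> \<noteq> 0\<close> by (simp add: c_def field_simps)
  \<comment> \<open>The sign of \<nu> is free, while \<open>averaging\<close> takes a positive
    period.\<close>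
  define P :: real where "P = 2 * pi * \<bar>of_int \<nu>\<bar>"
  have P: "P > 0" using \<open>\<nu> \<noteq> 0\<close> by (simp add: P_def)
  define \<mu> where "\<mu> t = t powr - (1 / real q)" for t
  have \<mu>_power: "\<mu> t ^ k = t powr - (real k / real q)" if "t > 0" for t k
    using that by (simp add: \<mu>_def powr_power)
  \<comment> \<open>Cutting off at \<epsilon>/2 makes \<theta> the identity on the whole strip where
    \<open>averaging\<close> compares the exact field with the model.\<close>
  have "\<epsilon> / 2 > 0" "\<epsilon> / 2 < \<R> / 2" using \<epsilon> by auto
  then obtain \<theta> where \<theta>: "smooth_on UNIV \<theta>" "\<And>x. \<theta> x \<in> {0<..<\<R>}"
    "\<And>x. x \<in> {\<epsilon> / 2..\<R> - \<epsilon> / 2} \<Longrightarrow> \<theta> x = x"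
    by (rule smooth_cutoff) blast
  have \<theta>_mem: "\<theta> x \<in> {0<..\<R>}" for x using \<theta>(2)[of x] by auto

  \<comment> \<open>Back from (R, \<Psi>, \<sigma>) to (\<rho>, \<phi>, \<sigma>), with the radius
    pushed into the domain by \<theta>.\<close>
  define h where "h x = (\<theta> (fst (fst (fst x))), snd (fst (fst x)) + c * snd (fst x), snd (fst x))"
    for x :: "((real \<times> real) \<times> real) \<times> real"
  define Gk where "Gk k x =
      ((\<lambda>(\<rho>, \<phi>, \<sigma>). fk k \<rho> \<phi> \<sigma>) (h x), (\<lambda>(\<rho>, \<phi>, \<sigma>). gk k \<rho> \<phi> \<sigma>) (h x) - c * s k)" for k x
  \<comment> \<open>The sum runs to N + 1: a Poincare remainder is of smaller order than the last
    term kept, so stopping at N would give only o(\<mu>^N) in place of O(\<mu>^(N+1)).\<close>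
  define G where "G x = (\<Sum>k=1..N + 1. snd x ^ k *\<^sub>R Gk k x)" for x
  define a where "a m = s\<^sub>0 + (\<Sum>k=1..N + 1. m ^ k * s k)" for m
  define F where "F t Z = (f (fst Z) (snd Z + c * S t) (S t) t,
      \<omega> + g (fst Z) (snd Z + c * S t) (S t) t - c * deriv S t)" for t Z
  have h: "smooth_on UNIV h" "range h \<subseteq> {0<..\<R>} \<times> UNIV \<times> UNIV"
    unfolding h_def using \<theta>_mem
    by (auto intro!: smooth_intros smooth_on_compose_UNIV[OF \<theta>(1)] simp del: greaterThanAtMost_iff)
  have "smooth_on UNIV (Gk k)" if "k \<ge> 1" for k
    unfolding Gk_def using fk_smooth gk_smooth that
    by (intro smooth_intros smooth_on_compose[OF _ h]) blast+
  then have G_smooth: "smooth_on UNIV G" unfolding G_def by (auto intro!: smooth_intros)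
  have a_smooth: "smooth_on UNIV a" unfolding a_def by (intro smooth_intros)
  \<comment> \<open>Advancing \<sigma> by P turns \<phi> = \<Psi> + c \<sigma> by a whole number of
    revolutions, since c has denominator \<nu>. This is why the model is P-periodic in \<sigma>
    although c need not be an integer.\<close>
  have turns: "c * P = of_int (\<kappa> * sgn \<nu>) * (2 * pi)"
    using \<open>\<nu> \<noteq> 0\<close> by (cases "\<nu> > 0") (simp_all add: c_def P_def)
  have P_turns: "P = of_int \<bar>\<nu>\<bar> * (2 * pi)" by (simp add: P_def)
  have shift_inv: "p k \<rho> (\<phi> + c * (\<sigma> + P)) (\<sigma> + P) = p k \<rho> (\<phi> + c * \<sigma>) \<sigma>"
    if per: "\<And>\<phi> \<sigma>. p k \<rho> (\<phi> + 2 * pi) \<sigma> = p k \<rho> \<phi> \<sigma>" "\<And>\<phi> \<sigma>. p k \<rho> \<phi> (\<sigma> + 2 * pi) = p k \<rho> \<phi> \<sigma>"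
    for p :: "nat \<Rightarrow> real \<Rightarrow> real \<Rightarrow> real \<Rightarrow> real" and k \<rho> \<phi> \<sigma>
  proof -
    have "\<phi> + c * (\<sigma> + P) = (\<phi> + c * \<sigma>) + of_int (\<kappa> * sgn \<nu>) * (2 * pi)"
      using turns by (simp add: distrib_left)
    then have "p k \<rho> (\<phi> + c * (\<sigma> + P)) (\<sigma> + P) = p k \<rho> (\<phi> + c * \<sigma>) (\<sigma> + P)"
      using periodic_int_multiple[of "\<lambda>\<phi>. p k \<rho> \<phi> (\<sigma> + P)" "2 * pi"] per(1) by presburger
    also have "\<dots> = p k \<rho> (\<phi> + c * \<sigma>) \<sigma>"
      unfolding P_turns
      using periodic_int_multiple[of "\<lambda>\<sigma>'. p k \<rho> (\<phi> + c * \<sigma>) \<sigma>'" "2 * pi"] per(2) by presburger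
    finally show ?thesis .
  qed
  have "Gk k ((Z + (0, 2 * pi), \<sigma>), m) = Gk k ((Z, \<sigma>), m) \<and>
      Gk k ((Z, \<sigma> + P), m) = Gk k ((Z, \<sigma>), m)" if "k \<ge> 1" for k Z \<sigma> m
  proof
    have per: "fk k (\<theta> x) (\<phi> + 2 * pi) \<sigma> = fk k (\<theta> x) \<phi> \<sigma>" "fk k (\<theta> x) \<phi> (\<sigma> + 2 * pi) = fk k (\<theta> x) \<phi> \<sigma>"
      "gk k (\<theta> x) (\<phi> + 2 * pi) \<sigma> = gk k (\<theta> x) \<phi> \<sigma>" "gk k (\<theta> x) \<phi> (\<sigma> + 2 * pi) = gk k (\<theta> x) \<phi> \<sigma>"
      for x \<phi> \<sigma> using fk_periodic gk_periodic that \<theta>_mem by blast+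
    have swap: "snd Z + 2 * pi + c * \<sigma> = snd Z + c * \<sigma> + 2 * pi" by simp
    show "Gk k ((Z + (0, 2 * pi), \<sigma>), m) = Gk k ((Z, \<sigma>), m)"
      by (simp add: Gk_def h_def per swap)
    show "Gk k ((Z, \<sigma> + P), m) = Gk k ((Z, \<sigma>), m)"
      by (simp add: Gk_def h_def shift_inv[of fk, OF per(1,2)] shift_inv[of gk, OF per(3,4)])
  qed
  then have G_per: "biperiodic (0, 2 * pi) P G"
    by (auto simp: biperiodic_def G_def intro!: sum.cong)

  have G_0: "G (y, 0) = 0" for y unfolding G_def by (rule sum.neutral) simp
  have "a 0 = s\<^sub>0" unfolding a_def by (simp add: sum.neutral)
  then have a_0: "a 0 \<noteq> 0" using s0_pos by simp
  have F_per: "F t (Z + (0, 2 * pi)) = F t Z" if "t > 0" "Z \<in> {0<..\<R>} \<times> UNIV" for t Z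
  proof -
    have swap: "snd Z + 2 * pi + c * S t = snd Z + c * S t + 2 * pi" by simp
    show ?thesis using f_periodic g_periodic that by (auto simp: F_def swap)
  qed
  define X where "X = {\<epsilon> / 2..\<R>} \<times> (UNIV :: real set) \<times> (UNIV :: real set)"
  \<comment> \<open>The remainder is o(\<mu>^(N+1)), so eventually the constant 1 suffices.\<close>
  have approx: "\<forall>\<^sub>F t in at_top. \<forall>\<rho>\<in>{\<epsilon> / 2..\<R>}. \<forall>\<phi> \<sigma>.
      \<bar>p \<rho> \<phi> \<sigma> t - (\<Sum>k=1..N + 1. \<mu> t ^ k * pk k \<rho> \<phi> \<sigma>)\<bar> \<le> \<mu> t ^ (N + 1)"
    if "\<forall>\<delta>>0. asymp_series_on ({\<delta>..\<R>} \<times> UNIV \<times> UNIV) q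
        (\<lambda>t (\<rho>, \<phi>, \<sigma>). p \<rho> \<phi> \<sigma> t) (\<lambda>k (\<rho>, \<phi>, \<sigma>). pk k \<rho> \<phi> \<sigma>)"
    for p :: "real \<Rightarrow> real \<Rightarrow> real \<Rightarrow> real \<Rightarrow> real" and pk
  proof -
    have "asymp_series_on X q (\<lambda>t (\<rho>, \<phi>, \<sigma>). p \<rho> \<phi> \<sigma> t) (\<lambda>k (\<rho>, \<phi>, \<sigma>). pk k \<rho> \<phi> \<sigma>)"
      using that \<open>\<epsilon> / 2 > 0\<close> by (simp add: X_def)
    then have "\<forall>\<^sub>F t in at_top. \<forall>x\<in>X. dist ((((\<lambda>(\<rho>, \<phi>, \<sigma>). p \<rho> \<phi> \<sigma> t) x -
        (\<Sum>k=1..N + 1. t powr (- (real k / real q)) * (\<lambda>(\<rho>, \<phi>, \<sigma>). pk k \<rho> \<phi> \<sigma>) x)) /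
        t powr (- (real (N + 1) / real q)))) 0 < 1"
      unfolding asymp_series_on_def uniform_limit_iff by (rule allE[of _ "N + 1"]) simp
    then show ?thesis
      using eventually_gt_at_top[of 0]
    proof eventually_elim
      case (elim t)
      show ?case
      proof (intro ballI allI)
        fix \<rho> \<phi> \<sigma> assume "\<rho> \<in> {\<epsilon> / 2..\<R>}"
        then have "\<bar>p \<rho> \<phi> \<sigma> t - (\<Sum>k=1..N + 1. \<mu> t ^ k * pk k \<rho> \<phi> \<sigma>)\<bar> / \<mu> t ^ (N + 1) < 1"
          unfolding \<mu>_power[OF elim(2)]
          using bspec[OF elim(1), of "(\<rho>, \<phi>, \<sigma>)"] by (simp add: X_def)
        moreover have "\<mu> t ^ (N + 1) > 0" using elim(2) by (simp add: \<mu>_def)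
        ultimately show "\<bar>p \<rho> \<phi> \<sigma> t - (\<Sum>k=1..N + 1. \<mu> t ^ k * pk k \<rho> \<phi> \<sigma>)\<bar> \<le> \<mu> t ^ (N + 1)"
          by (simp add: pos_divide_less_eq)
      qed
    qed
  qed
  have Sa: "\<forall>\<^sub>F t in at_top. \<bar>deriv S t - a (\<mu> t)\<bar> \<le> \<mu> t ^ (N + 1)"
  proof -
    have "\<forall>\<^sub>F t in at_top. norm (deriv S t - s\<^sub>0 - (\<Sum>k=1..N + 1. t powr (- (real k / real q)) * s k))
        \<le> 1 * norm (t powr (- (real (N + 1) / real q)))"
      using S_expansion unfolding asymp_series_def by (intro landau_o.smallD zero_less_one) blast
    then show ?thesis using eventually_gt_at_top[of 0]
      by eventually_elim (simp only: a_def \<mu>_power, simp add: algebra_simps)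
  qed
  \<comment> \<open>The constant collects one unit each from f and g, and \<bar>c\<bar> from the
    error of S', which enters through \<Psi>'.\<close>
  have FG: "\<forall>\<^sub>F t in at_top. \<forall>Z\<in>{\<epsilon> / 2..\<R> - \<epsilon> / 2} \<times> UNIV.
      norm (F t Z - G ((Z, S t), t powr - (1 / real q)))
      \<le> (2 + \<bar>c\<bar>) * (t powr - (1 / real q)) ^ (N + 1)"
    using approx[OF f_expansion] approx[OF g_expansion] Sa
  proof eventually_elim
    case (elim t)
    show ?case
      unfolding \<mu>_def[symmetric]
    proof
      fix Z :: "real \<times> real" assume Z: "Z \<in> {\<epsilon> / 2..\<R> - \<epsilon> / 2} \<times> UNIV"
      then have R: "fst Z \<in> {\<epsilon> / 2..\<R>}" "\<theta> (fst Z) = fst Z"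
        using \<epsilon> \<theta>(3) by (auto simp: mem_Times_iff)
      let ?y = "snd Z + c * S t" and ?m = "\<mu> t ^ (N + 1)"
      let ?f = "f (fst Z) ?y (S t) t - (\<Sum>k=1..N + 1. \<mu> t ^ k * fk k (fst Z) ?y (S t))"
      let ?g = "g (fst Z) ?y (S t) t - (\<Sum>k=1..N + 1. \<mu> t ^ k * gk k (fst Z) ?y (S t))"
      let ?s = "deriv S t - a (\<mu> t)"
      \<comment> \<open>Here \<omega> cancels as \<open>c * s\<^sub>0\<close>, and the terms
        \<open>c * s k\<close> of \<open>Gk\<close> combine to the model \<open>a\<close> of
        S'.\<close>
      have eq: "F t Z - G ((Z, S t), \<mu> t) = (?f, ?g - c * ?s)"
        by (simp add: F_def G_def Gk_def h_def R(2) prod_eq_iff fst_sum snd_sum a_def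
            right_diff_distrib distrib_left sum_subtractf sum_distrib_left c[symmetric] mult.left_commute)
      have "norm (F t Z - G ((Z, S t), \<mu> t)) \<le> \<bar>?f\<bar> + \<bar>?g - c * ?s\<bar>"
        unfolding eq using norm_Pair_le[of ?f "?g - c * ?s"] by (simp only: real_norm_def)
      also have "\<dots> \<le> ?m + (?m + \<bar>c\<bar> * ?m)"
      proof (rule add_mono)
        show "\<bar>?f\<bar> \<le> ?m" by (rule elim(1)[rule_format, OF R(1)])
        have "\<bar>?g\<bar> \<le> ?m" by (rule elim(2)[rule_format, OF R(1)])
        then show "\<bar>?g - c * ?s\<bar> \<le> ?m + \<bar>c\<bar> * ?m"
          by (rule order_trans[OF abs_triangle_ineq4 add_mono])
            (unfold abs_mult, rule mult_left_mono[OF elim(3) abs_ge_zero])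
      qed
      also have "\<dots> = (2 + \<bar>c\<bar>) * ?m" by algebra
      finally show "norm (F t Z - G ((Z, S t), \<mu> t)) \<le> (2 + \<bar>c\<bar>) * ?m" .
    qed
  qed
  \<comment> \<open>The bound is weakened because \<open>averaging\<close> takes a single constant
    for both errors.\<close>
  have Sa': "\<forall>\<^sub>F t in at_top. \<bar>deriv S t - a (t powr - (1 / real q))\<bar>
      \<le> (2 + \<bar>c\<bar>) * (t powr - (1 / real q)) ^ (N + 1)"
    using Sa eventually_gt_at_top[of 0] unfolding \<mu>_def[symmetric]
  proof eventually_elim
    case (elim t)
    have "1 * \<mu> t ^ (N + 1) \<le> (2 + \<bar>c\<bar>) * \<mu> t ^ (N + 1)"
      using elim by (intro mult_right_mono) (auto simp: \<mu>_def)
    then show ?case using elim by linarith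
  qed
  obtain t\<^sub>0 U l W C where t0: "t\<^sub>0 > 0" and U_smooth: "smooth_on (UNIV \<times> {0<..}) U"
    and U_per: "\<And>Z t. U (Z + (0, 2 * pi), t) = U (Z, t)"
    and U_small: "\<And>t Z. t \<ge> t\<^sub>0 \<Longrightarrow> Z \<in> {0<..\<R>} \<times> UNIV \<Longrightarrow> norm (U (Z, t)) \<le> \<epsilon>"
    and inj: "\<And>t. t \<ge> t\<^sub>0 \<Longrightarrow> inj_on (\<lambda>Z. Z + U (Z, t)) ({0<..\<R>} \<times> UNIV)"
    and surj: "\<And>t. t \<ge> t\<^sub>0 \<Longrightarrow>
      {\<epsilon>..\<R> - \<epsilon>} \<times> UNIV \<subseteq> (\<lambda>Z. Z + U (Z, t)) ` ({0<..\<R>} \<times> UNIV)"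
    and ode: "\<And>T Z s. T \<subseteq> {t\<^sub>0..} \<Longrightarrow> Z ` T \<subseteq> {0<..\<R>} \<times> UNIV \<Longrightarrow> s \<in> T \<Longrightarrow>
      (Z has_vector_derivative F s (Z s)) (at s within T) \<longleftrightarrow>
      ((\<lambda>t. Z t + U (Z t, t)) has_vector_derivative
        (\<Sum>k=1..N. (s powr - (1 / real q)) ^ k *\<^sub>R l k (Z s + U (Z s, s)))
          + W (Z s + U (Z s, s)) s) (at s within T)"
    and l_per: "\<And>k Z. l k (Z + (0, 2 * pi)) = l k Z"
    and W_per: "\<And>t z. t \<ge> t\<^sub>0 \<Longrightarrow> W (z + (0, 2 * pi)) t = W z t"
    and W_small: "\<forall>\<^sub>F t in at_top. \<forall>z\<in>{\<epsilon>..\<R> - \<epsilon>} \<times> UNIV.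
      norm (W z t) \<le> C * (t powr - (1 / real q)) ^ (N + 1)"
  proof (rule averaging[OF \<open>q > 0\<close> \<epsilon> P S_smooth G_smooth G_per G_0 a_smooth a_0 _ FG Sa'],
      goal_cases)
    case (1 t Z)
    from 1(2,3) show ?case by (rule F_per)
  next
    case (2 t\<^sub>0 U l W C')
    from 2 show thesis
      by (intro that[where t\<^sub>0 = t\<^sub>0 and U = U and l = l and W = W and C = C'])
  qed
  have C: "\<forall>\<^sub>F t in at_top. \<forall>z\<in>{\<epsilon>..\<R> - \<epsilon>} \<times> UNIV.
      norm (W z t) \<le> C * t powr (- (real (N + 1) / real q))"
    using W_small eventually_gt_at_top[of 0] unfolding \<mu>_def[symmetric]
    by eventually_elim (simp only: \<mu>_power)
  have dS: "(S has_real_derivative deriv S t) (at t)" if "t > 0" for t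
    using smooth_on_imp_has_real_derivative[OF S_smooth open_greaterThan] that by simp
  have solves: "solves_on T (\<lambda>\<rho> \<phi> t. f \<rho> \<phi> (S t) t) (\<lambda>\<rho> \<phi> t. \<omega> + g \<rho> \<phi> (S t) t) \<rho> \<phi> \<longleftrightarrow>
      solves_on T
        (\<lambda>r \<psi> t. (\<Sum>k=1..N. t powr (- (real k / real q)) * fst (l k (r, \<psi>))) + fst (W (r, \<psi>) t))
        (\<lambda>r \<psi> t. (\<Sum>k=1..N. t powr (- (real k / real q)) * snd (l k (r, \<psi>))) + snd (W (r, \<psi>) t))
        (\<lambda>t. \<rho> t + fst (U ((\<rho> t, \<phi> t - c * S t), t)))
        (\<lambda>t. \<phi> t - c * S t + snd (U ((\<rho> t, \<phi> t - c * S t), t)))"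
    if T: "T \<subseteq> {t\<^sub>0..}" and \<rho>: "\<rho> ` T \<subseteq> {0<..\<R>}" for T \<rho> \<phi>
  proof -
    define Z where "Z t = (\<rho> t, \<phi> t - c * S t)" for t
    have "((\<lambda>t. (\<rho> t, \<phi> t)) has_vector_derivative
        (f (\<rho> s) (\<phi> s) (S s) s, \<omega> + g (\<rho> s) (\<phi> s) (S s) s)) (at s within T) \<longleftrightarrow>
        ((\<lambda>t. Z t + U (Z t, t)) has_vector_derivative
        (\<Sum>k=1..N. s powr (- (real k / real q)) *\<^sub>R l k (Z s + U (Z s, s)))
          + W (Z s + U (Z s, s)) s) (at s within T)" if s: "s \<in> T" for s
    proof -
      have s0: "s > 0" using s T t0 by force
      have dcS: "((\<lambda>t. c * S t) has_vector_derivative c * deriv S s) (at s within T)"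
        using DERIV_cmult[OF dS[OF s0]] has_vector_derivative_at_within
        unfolding has_real_derivative_iff_has_vector_derivative by blast
      \<comment> \<open>Subtracting or adding the differentiable function c S passes between \<phi>
        and \<Psi> in both directions, with no prior regularity of either.\<close>
      have "(\<phi> has_vector_derivative \<omega> + g (\<rho> s) (\<phi> s) (S s) s) (at s within T) \<longleftrightarrow>
          ((\<lambda>t. \<phi> t - c * S t) has_vector_derivative
            \<omega> + g (\<rho> s) (\<phi> s) (S s) s - c * deriv S s) (at s within T)"
        using has_vector_derivative_diff[OF _ dcS, of \<phi> "\<omega> + g (\<rho> s) (\<phi> s) (S s) s"]
          has_vector_derivative_add[OF _ dcS, of "\<lambda>t. \<phi> t - c * S t"
            "\<omega> + g (\<rho> s) (\<phi> s) (S s) s - c * deriv S s"] by auto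
      then have "((\<lambda>t. (\<rho> t, \<phi> t)) has_vector_derivative
          (f (\<rho> s) (\<phi> s) (S s) s, \<omega> + g (\<rho> s) (\<phi> s) (S s) s)) (at s within T) \<longleftrightarrow>
          (Z has_vector_derivative F s (Z s)) (at s within T)"
        by (simp add: Z_def[abs_def] F_def has_vector_derivative_Pair_iff)
      also have "\<dots> \<longleftrightarrow> ((\<lambda>t. Z t + U (Z t, t)) has_vector_derivative
          (\<Sum>k=1..N. \<mu> s ^ k *\<^sub>R l k (Z s + U (Z s, s))) + W (Z s + U (Z s, s)) s) (at s within T)"
        unfolding \<mu>_def using \<rho> by (intro ode T s) (auto simp: Z_def)
      finally show ?thesis by (simp only: \<mu>_power[OF s0])
    qed
    moreover have "(\<lambda>t. (\<rho> t + fst (U ((\<rho> t, \<phi> t - c * S t), t)),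
        \<phi> t - c * S t + snd (U ((\<rho> t, \<phi> t - c * S t), t)))) = (\<lambda>t. Z t + U (Z t, t))"
      by (simp add: fun_eq_iff Z_def prod_eq_iff)
    moreover have "((\<Sum>k=1..N. v k * fst (l k z)) + fst (W z s), (\<Sum>k=1..N. v k * snd (l k z)) + snd (W z s))
        = (\<Sum>k=1..N. v k *\<^sub>R l k z) + W z s" for v z s
      by (simp add: prod_eq_iff fst_sum snd_sum)
    moreover have "(\<rho> t + fst (U ((\<rho> t, \<phi> t - c * S t), t)),
        \<phi> t - c * S t + snd (U ((\<rho> t, \<phi> t - c * S t), t))) = Z t + U (Z t, t)" for t
      by (simp add: Z_def prod_eq_iff)
    ultimately show ?thesis
      by (simp only: solves_on_iff_has_vector_derivative cong: ball_cong)
  qed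
  have comp: "smooth_on ({0<..\<R>} \<times> UNIV \<times> {0<..}) (\<lambda>(R, \<Psi>, t). U ((R, \<Psi>), t))"
    unfolding case_prod_beta' by (rule smooth_on_compose[OF U_smooth]) (auto intro!: smooth_intros)
  show ?case
  proof (rule exI[of _ t\<^sub>0], rule exI[of _ "\<lambda>R \<Psi> t. fst (U ((R, \<Psi>), t))"],
      rule exI[of _ "\<lambda>R \<Psi> t. snd (U ((R, \<Psi>), t))"], rule exI[of _ "\<lambda>k r \<psi>. fst (l k (r, \<psi>))"],
      rule exI[of _ "\<lambda>k r \<psi>. snd (l k (r, \<psi>))"], rule exI[of _ "\<lambda>r \<psi> \<sigma> t. fst (W (r, \<psi>) t)"],
      rule exI[of _ "\<lambda>r \<psi> \<sigma> t. snd (W (r, \<psi>) t)"], fold c_def, intro conjI, goal_cases)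
    case 1
    show ?case by (rule t0)
  next
    case 2
    show ?case using smooth_on_fst[OF comp] by (simp only: case_prod_beta')
  next
    case 3
    show ?case using smooth_on_snd[OF comp] by (simp only: case_prod_beta')
  next
    case 4
    show ?case using U_per[of "(_, _)"] by simp
  next
    case 5
    have "\<bar>fst (U ((R, \<Psi>), t))\<bar> \<le> \<epsilon>" "\<bar>snd (U ((R, \<Psi>), t))\<bar> \<le> \<epsilon>"
      if "R \<in> {0<..\<R>}" "t \<ge> t\<^sub>0" for R \<Psi> t
      using U_small[of t "(R, \<Psi>)"] that norm_fst_le[of "fst (U ((R, \<Psi>), t))" "snd (U ((R, \<Psi>), t))"]
        norm_snd_le[of "snd (U ((R, \<Psi>), t))" "fst (U ((R, \<Psi>), t))"] by auto
    then show ?case by blast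
  next
    case 6
    have map_eq: "(\<lambda>(R, \<Psi>). (R + fst (U ((R, \<Psi>), t)), \<Psi> + snd (U ((R, \<Psi>), t)))) = (\<lambda>Z. Z + U (Z, t))" for t
      by (simp add: fun_eq_iff prod_eq_iff)
    have "bij_betw (\<lambda>(\<rho>, \<phi>). (\<rho>, \<phi> - c * S t)) ({0<..\<R>} \<times> UNIV) ({0<..\<R>} \<times> UNIV)" for t
      by (rule bij_betw_byWitness[where f' = "\<lambda>(\<rho>, \<phi>). (\<rho>, \<phi> + c * S t)"]) auto
    then show ?case unfolding map_eq using inj surj by blast
  next
    case 7
    show ?case using solves by blast
  next
    case 8
    show ?case using l_per[of _ "(_, _)"] by simp
  next
    case 9
    show ?case using W_per[of _ "(_, _)"] by simp
  next
    case 10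
    have "\<bar>fst (W (r, \<psi>) t)\<bar> \<le> norm (W (r, \<psi>) t)" "\<bar>snd (W (r, \<psi>) t)\<bar> \<le> norm (W (r, \<psi>) t)" for r \<psi> t
      using norm_fst_le[of "fst (W (r, \<psi>) t)" "snd (W (r, \<psi>) t)"]
        norm_snd_le[of "snd (W (r, \<psi>) t)" "fst (W (r, \<psi>) t)"] by simp_all
    note components = this[THEN order_trans]
    show ?case
      by (rule exI[of _ C], rule eventually_mono[OF C]) (auto intro!: components)
  qed
qed

end
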